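(* Let $G=G(\Gamma)$ be a tubular group. If $\Gamma$ is a tree then $G(\Gamma)$ is free by $\mathbb{Z}$.
   Context: A tubular group $G=G(\Gamma)$ is the fundamental group of a graph of groups over a finite connected graph $\Gamma$ in which every vertex group is isomorphic to $\mathbb{Z}^2$ and every edge group is isomorphic to $\mathbb{Z}$. A free by $\mathbb{Z}$ group is a group of the form $F\rtimes_\alpha\mathbb{Z}$ where $F$ is a free group of finite rank and $\alpha$ is an automorphism of $F$. *)

theory Defs
  imports "HOL-Algebra.Bij" "HOL-Algebra.Elementary_Groups" "Graph_Theory.Graph_Theory"
begin

section \<open>Groups given by generators and relations\<close>

text \<open>
  A letter \<open>(x, True)\<close> stands for the generator \<open>x\<close> and \<open>(x, False)\<close> for its formal inverse.
  A relation is a pair \<open>(l, r)\<close> of words, read as \<open>l = r\<close>.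
\<close>

type_synonym 'x word = "('x \<times> bool) list"

definition words :: "'x set \<Rightarrow> 'x word set" where
  "words X = lists (X \<times> UNIV)"

inductive word_eq :: "'x set \<Rightarrow> ('x word \<times> 'x word) set \<Rightarrow> 'x word \<Rightarrow> 'x word \<Rightarrow> bool"
  for X R where
  refl: "w \<in> words X \<Longrightarrow> word_eq X R w w"
| sym: "word_eq X R v w \<Longrightarrow> word_eq X R w v"
| trans: "word_eq X R u v \<Longrightarrow> word_eq X R v w \<Longrightarrow> word_eq X R u w"
| cancel: "u \<in> words X \<Longrightarrow> v \<in> words X \<Longrightarrow> x \<in> X \<Longrightarrow>
    word_eq X R (u @ [(x, b), (x, \<not> b)] @ v) (u @ v)"
| rel: "u \<in> words X \<Longrightarrow> v \<in> words X \<Longrightarrow> (l, r) \<in> R \<Longrightarrow> l \<in> words X \<Longrightarrow> r \<in> words X \<Longrightarrow>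
    word_eq X R (u @ l @ v) (u @ r @ v)"

definition word_rel :: "'x set \<Rightarrow> ('x word \<times> 'x word) set \<Rightarrow> ('x word \<times> 'x word) set" where
  "word_rel X R = {(v, w). word_eq X R v w}"

definition presented_group :: "'x set \<Rightarrow> ('x word \<times> 'x word) set \<Rightarrow> 'x word set monoid" where
  "presented_group X R =
    \<lparr>carrier = words X // word_rel X R,
     monoid.mult = \<lambda>A B. \<Union>a\<in>A. \<Union>b\<in>B. word_rel X R `` {a @ b},
     one = word_rel X R `` {[]}\<rparr>"

definition free_group :: "'x set \<Rightarrow> 'x word set monoid" where
  "free_group X = presented_group X {}"

lemma words_simps [simp]:
  "[] \<in> words X"
  "a # w \<in> words X \<longleftrightarrow> fst a \<in> X \<and> w \<in> words X"
  "v @ w \<in> words X \<longleftrightarrow> v \<in> words X \<and> w \<in> words X"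
  by (auto simp: words_def mem_Times_iff)

lemma word_eq_words: "word_eq X R v w \<Longrightarrow> v \<in> words X \<and> w \<in> words X"
  by (induction rule: word_eq.induct) auto

lemma word_eq_appendL:
  "word_eq X R v w \<Longrightarrow> u \<in> words X \<Longrightarrow> word_eq X R (u @ v) (u @ w)"
proof (induction rule: word_eq.induct)
  case (cancel a c x b)
  then show ?case using word_eq.cancel[of "u @ a" X c x R b] by simp
next
  case (rel a c l r)
  then show ?case using word_eq.rel[of "u @ a" X c l r R] by simp
next
  case (sym v w)
  then show ?case by (intro word_eq.sym[OF sym.IH])
next
  case (trans a b c)
  then show ?case by (intro word_eq.trans[OF trans.IH])
qed (simp add: word_eq.refl)

lemma word_eq_appendR:
  "word_eq X R v w \<Longrightarrow> u \<in> words X \<Longrightarrow> word_eq X R (v @ u) (w @ u)"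
proof (induction rule: word_eq.induct)
  case (cancel a c x b)
  then show ?case using word_eq.cancel[of a X "c @ u" x R b] by simp
next
  case (rel a c l r)
  then show ?case using word_eq.rel[of a X "c @ u" l r R] by simp
next
  case (sym v w)
  then show ?case by (intro word_eq.sym[OF sym.IH])
next
  case (trans a b c)
  then show ?case by (intro word_eq.trans[OF trans.IH])
qed (simp add: word_eq.refl)

lemma equiv_word_rel: "equiv (words X) (word_rel X R)"
proof (rule equivI)
  show "word_rel X R \<subseteq> words X \<times> words X"
    using word_eq_words unfolding word_rel_def by blast
  show "refl_on (words X) (word_rel X R)"
    by (auto simp: refl_on_def word_rel_def intro: word_eq.refl)
  show "sym (word_rel X R)"
    by (rule symI) (simp add: word_rel_def word_eq.sym)
  show "trans (word_rel X R)"
  proof (rule transI)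
    show "(u, w) \<in> word_rel X R" if "(u, v) \<in> word_rel X R" "(v, w) \<in> word_rel X R" for u v w
      using that word_eq.trans[of X R u v w] by (simp add: word_rel_def)
  qed
qed

lemma word_rel_congruent2:
  "congruent2 (word_rel X R) (word_rel X R) (\<lambda>a b. word_rel X R `` {a @ b})"
  unfolding congruent2_def
proof (intro allI impI ballI, clarify)
  fix a a' b b'
  assume "(a, a') \<in> word_rel X R" "(b, b') \<in> word_rel X R"
  then have *: "word_eq X R a a'" "word_eq X R b b'" by (auto simp: word_rel_def)
  have "word_eq X R (a @ b) (a' @ b')"
    using word_eq_appendR[OF *(1)] word_eq_appendL[OF *(2)] word_eq_words[OF *(1)]
      word_eq_words[OF *(2)] word_eq.trans[of X R "a @ b" "a' @ b" "a' @ b'"] by blast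
  then show "word_rel X R `` {a @ b} = word_rel X R `` {a' @ b'}"
    using equiv_class_eq[OF equiv_word_rel] by (simp add: word_rel_def)
qed

lemma presented_group_mult:
  "v \<in> words X \<Longrightarrow> w \<in> words X \<Longrightarrow>
    word_rel X R `` {v} \<otimes>\<^bsub>presented_group X R\<^esub> word_rel X R `` {w} = word_rel X R `` {v @ w}"
  unfolding presented_group_def
  using UN_equiv_class2[OF equiv_word_rel equiv_word_rel word_rel_congruent2] by simp

lemma word_inverse:
  assumes "w \<in> words X"
  shows "word_eq X R (rev (map (\<lambda>(x, b). (x, \<not> b)) w) @ w) []"
  using assms
proof (induction w)
  case (Cons a w)
  obtain x b where a: "a = (x, b)" by fastforce
  let ?v = "rev (map (\<lambda>(x, b). (x, \<not> b)) w)"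
  have v: "?v \<in> words X"
    using Cons.prems by (auto simp: words_def)
  have "word_eq X R (?v @ [(x, \<not> b), (x, \<not> \<not> b)] @ w) (?v @ w)"
    using v Cons.prems a by (intro word_eq.cancel) auto
  moreover have "word_eq X R (?v @ w) []"
    using Cons by simp
  ultimately have "word_eq X R (?v @ [(x, \<not> b), (x, \<not> \<not> b)] @ w) []"
    by (rule word_eq.trans)
  then show ?case using a by simp
qed (simp add: word_eq.refl)

lemma group_presented_group: "group (presented_group X R)"
proof (rule groupI)
  let ?c = "\<lambda>w. word_rel X R `` {w}"
  have car: "A \<in> carrier (presented_group X R) \<longleftrightarrow> (\<exists>w\<in>words X. A = ?c w)" for A
    by (auto simp: presented_group_def quotient_def)
  have one: "\<one>\<^bsub>presented_group X R\<^esub> = ?c []"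
    by (simp add: presented_group_def)
  note m = presented_group_mult
  show "x \<otimes>\<^bsub>presented_group X R\<^esub> y \<in> carrier (presented_group X R)"
    if xy: "x \<in> carrier (presented_group X R)" "y \<in> carrier (presented_group X R)" for x y
  proof -
    obtain v w where vw: "v \<in> words X" "w \<in> words X" "x = ?c v" "y = ?c w"
      using xy unfolding car by auto
    then have "x \<otimes>\<^bsub>presented_group X R\<^esub> y = ?c (v @ w)" by (simp only: m)
    then show ?thesis unfolding car using vw by (intro bexI[of _ "v @ w"]) simp_all
  qed
  show "\<one>\<^bsub>presented_group X R\<^esub> \<in> carrier (presented_group X R)"
    unfolding car one by (rule bexI[of _ "[]"]) simp_all
  show "x \<otimes>\<^bsub>presented_group X R\<^esub> y \<otimes>\<^bsub>presented_group X R\<^esub> z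
      = x \<otimes>\<^bsub>presented_group X R\<^esub> (y \<otimes>\<^bsub>presented_group X R\<^esub> z)"
    if "x \<in> carrier (presented_group X R)" "y \<in> carrier (presented_group X R)"
      "z \<in> carrier (presented_group X R)" for x y z
    using that unfolding car by (auto simp: m)
  show "\<one>\<^bsub>presented_group X R\<^esub> \<otimes>\<^bsub>presented_group X R\<^esub> x = x"
    if "x \<in> carrier (presented_group X R)" for x
    using that unfolding car one by (auto simp: m)
  show "\<exists>y\<in>carrier (presented_group X R). y \<otimes>\<^bsub>presented_group X R\<^esub> x = \<one>\<^bsub>presented_group X R\<^esub>"
    if x: "x \<in> carrier (presented_group X R)" for x
  proof -
    obtain w where w: "w \<in> words X" "x = ?c w" using x unfolding car by auto
    let ?v = "rev (map (\<lambda>(x, b). (x, \<not> b)) w)"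
    have v: "?v \<in> words X" using w by (auto simp: words_def)
    have "?c (?v @ w) = ?c []"
      by (rule equiv_class_eq[OF equiv_word_rel]) (simp add: word_rel_def word_inverse[OF w(1)])
    moreover have "?c ?v \<in> carrier (presented_group X R)"
      unfolding car using v by (rule bexI[rotated]) (rule HOL.refl)
    ultimately show ?thesis
      using m[OF v w(1)] one w(2) by (intro bexI[of _ "?c ?v"]) simp_all
  qed
qed

corollary group_free_group: "group (free_group X)"
  by (simp add: free_group_def group_presented_group)


section \<open>Semidirect products and free by \<open>\<int>\<close> groups\<close>

definition semidirect_product ::
  "('a, 'm) monoid_scheme \<Rightarrow> ('b, 'n) monoid_scheme \<Rightarrow> ('b \<Rightarrow> 'a \<Rightarrow> 'a) \<Rightarrow> ('a \<times> 'b) monoid" where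
  "semidirect_product N H \<theta> =
    \<lparr>carrier = carrier N \<times> carrier H,
     monoid.mult = \<lambda>(a, x) (b, y). (a \<otimes>\<^bsub>N\<^esub> \<theta> x b, x \<otimes>\<^bsub>H\<^esub> y),
     one = (\<one>\<^bsub>N\<^esub>, \<one>\<^bsub>H\<^esub>)\<rparr>"

lemma group_semidirect_product:
  assumes "group N" "group H" "\<theta> \<in> hom H (AutoGroup N)"
  shows "group (semidirect_product N H \<theta>)"
proof -
  interpret N: group N by fact
  interpret H: group H by fact
  interpret A: group "AutoGroup N" by (rule N.AutoGroup)
  interpret t: group_hom H "AutoGroup N" \<theta>
    by (simp add: group_hom_def group_hom_axioms_def assms N.AutoGroup)
  have aut: "\<theta> x \<in> auto N" if "x \<in> carrier H" for x
    using t.hom_closed[OF that] by (simp add: AutoGroup_def)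
  have cl [simp]: "\<theta> x a \<in> carrier N" if "x \<in> carrier H" "a \<in> carrier N" for x a
    using aut[OF that(1)] that(2) by (auto simp: auto_def hom_def)
  have hm [simp]: "\<theta> x (a \<otimes>\<^bsub>N\<^esub> b) = \<theta> x a \<otimes>\<^bsub>N\<^esub> \<theta> x b"
    if "x \<in> carrier H" "a \<in> carrier N" "b \<in> carrier N" for x a b
    using aut[OF that(1)] that by (auto simp: auto_def hom_def)
  have mul [simp]: "\<theta> (x \<otimes>\<^bsub>H\<^esub> y) a = \<theta> x (\<theta> y a)"
    if "x \<in> carrier H" "y \<in> carrier H" "a \<in> carrier N" for x y a
    using t.hom_mult[OF that(1,2)] aut[OF that(1)] aut[OF that(2)] that(3)
    by (simp add: AutoGroup_def BijGroup_def auto_def compose_def)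
  have one [simp]: "\<theta> \<one>\<^bsub>H\<^esub> a = a" if "a \<in> carrier N" for a
    using t.hom_one that by (simp add: AutoGroup_def BijGroup_def)
  show ?thesis
  proof (rule groupI, goal_cases)
    case (5 p)
    obtain a x where p: "p = (a, x)" "a \<in> carrier N" "x \<in> carrier H"
      using 5 by (auto simp: semidirect_product_def)
    let ?y = "inv\<^bsub>H\<^esub> x"
    have y: "?y \<in> carrier H" using p by simp
    have "\<theta> ?y \<one>\<^bsub>N\<^esub> = \<one>\<^bsub>N\<^esub>"
      using hm[OF y N.one_closed N.one_closed] cl[OF y N.one_closed] N.l_cancel_one by simp
    moreover have "\<theta> ?y (inv\<^bsub>N\<^esub> a) \<otimes>\<^bsub>N\<^esub> \<theta> ?y a = \<theta> ?y \<one>\<^bsub>N\<^esub>"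
      using hm[OF y N.inv_closed[OF p(2)] p(2)] p(2) by simp
    ultimately show ?case
      using p y cl[OF y N.inv_closed[OF p(2)]]
      by (intro bexI[of _ "(\<theta> ?y (inv\<^bsub>N\<^esub> a), ?y)"]) (simp_all add: semidirect_product_def)
  qed (auto simp: semidirect_product_def N.m_assoc H.m_assoc simp del: t.hom_mult t.hom_one)
qed

text \<open>\<open>F \<rtimes>\<^sub>\<alpha> \<int>\<close>, where \<open>k \<in> \<int>\<close> acts on \<open>F\<close> as the automorphism \<open>\<alpha>\<^sup>k\<close>.\<close>

definition mapping_torus :: "('a, 'm) monoid_scheme \<Rightarrow> ('a \<Rightarrow> 'a) \<Rightarrow> ('a \<times> int) monoid" where
  "mapping_torus F \<alpha> = semidirect_product F integer_group (\<lambda>k::int. \<alpha> [^]\<^bsub>AutoGroup F\<^esub> k)"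

definition free_by_Z :: "('a, 'm) monoid_scheme \<Rightarrow> bool" where
  "free_by_Z G \<longleftrightarrow>
    (\<exists>n::nat. \<exists>\<alpha>\<in>auto (free_group {..<n}). G \<cong> mapping_torus (free_group {..<n}) \<alpha>)"

lemma group_mapping_torus:
  assumes "group F" "\<alpha> \<in> auto F"
  shows "group (mapping_torus F \<alpha>)"
proof -
  interpret A: group "AutoGroup F" by (rule group.AutoGroup[OF assms(1)])
  have "\<alpha> \<in> carrier (AutoGroup F)" using assms by (simp add: AutoGroup_def)
  then have "(\<lambda>k::int. \<alpha> [^]\<^bsub>AutoGroup F\<^esub> k) \<in> hom integer_group (AutoGroup F)"
    by (auto simp: hom_def A.int_pow_mult)
  then show ?thesis
    unfolding mapping_torus_def by (intro group_semidirect_product assms) auto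
qed


section \<open>Graphs of groups\<close>

text \<open>
  Graphs are taken in the sense of Serre: loops and multiple edges are allowed, and every geometric
  edge is a pair of mutually inverse arcs \<open>a\<close> and \<open>arev a\<close>.  The library predicate \<open>tree\<close> is not
  usable here: it forbids directed cycles, and the closed walk \<open>[a, arev a]\<close> is one.  A circuit of
  the undirected graph is a cycle that does not traverse an edge in both directions.
\<close>

definition circuit :: "('v, 'e) pre_digraph \<Rightarrow> ('e \<Rightarrow> 'e) \<Rightarrow> 'e list \<Rightarrow> bool" where
  "circuit \<Gamma> arev p \<longleftrightarrow> pre_digraph.cycle \<Gamma> p \<and> (\<forall>a\<in>set p. arev a \<notin> set p)"

definition serre_tree :: "('v, 'e) pre_digraph \<Rightarrow> ('e \<Rightarrow> 'e) \<Rightarrow> bool" where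
  "serre_tree \<Gamma> arev \<longleftrightarrow> connected \<Gamma> \<and> (\<nexists>p. circuit \<Gamma> arev p)"

definition maximal_tree ::
  "('v, 'e) pre_digraph \<Rightarrow> ('e \<Rightarrow> 'e) \<Rightarrow> ('v, 'e) pre_digraph \<Rightarrow> bool" where
  "maximal_tree \<Gamma> arev T \<longleftrightarrow>
    spanning T \<Gamma> \<and> (\<forall>a\<in>arcs T. arev a \<in> arcs T) \<and> serre_tree T arev"

text \<open>
  Both orientations of an edge carry the same edge group, and \<open>\<phi> a\<close> embeds it into the vertex group
  at the head of \<open>a\<close>; hence \<open>\<phi> (arev a)\<close> embeds it into the vertex group at the tail of \<open>a\<close>.
\<close>

locale graph_of_groups = bidirected_digraph \<Gamma> arev
  for \<Gamma> :: "('v, 'e) pre_digraph" and arev :: "'e \<Rightarrow> 'e" +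
  fixes VG :: "'v \<Rightarrow> ('g, 'm) monoid_scheme"
    and EG :: "'e \<Rightarrow> ('h, 'n) monoid_scheme"
    and \<phi> :: "'e \<Rightarrow> 'h \<Rightarrow> 'g"
  assumes vertex_group: "v \<in> verts \<Gamma> \<Longrightarrow> group (VG v)"
    and edge_group: "a \<in> arcs \<Gamma> \<Longrightarrow> group (EG a)"
    and edge_group_arev: "a \<in> arcs \<Gamma> \<Longrightarrow> EG (arev a) = EG a"
    and edge_mono: "a \<in> arcs \<Gamma> \<Longrightarrow> \<phi> a \<in> mon (EG a) (VG (head \<Gamma> a))"

datatype ('v, 'g, 'e) generator = Vert 'v 'g | Stable 'e

definition pi1_generators ::
  "('v, 'e) pre_digraph \<Rightarrow> ('v \<Rightarrow> ('g, 'm) monoid_scheme) \<Rightarrow> ('v, 'g, 'e) generator set" where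
  "pi1_generators \<Gamma> VG = {Vert v g | v g. v \<in> verts \<Gamma> \<and> g \<in> carrier (VG v)} \<union> Stable ` arcs \<Gamma>"

text \<open>
  In order: the multiplication tables of the vertex groups; \<open>t\<^bsub>arev a\<^esub> = t\<^sub>a\<^sup>-\<^sup>1\<close>;
  \<open>t\<^sub>a \<phi>\<^sub>a(x) t\<^sub>a\<^sup>-\<^sup>1 = \<phi>\<^bsub>arev a\<^esub>(x)\<close> for \<open>x\<close> in the edge group; \<open>t\<^sub>a = 1\<close> for \<open>a\<close> in the
  maximal tree \<open>T\<close>.
\<close>

definition pi1_relations ::
  "('v, 'e) pre_digraph \<Rightarrow> ('e \<Rightarrow> 'e) \<Rightarrow> ('v \<Rightarrow> ('g, 'm) monoid_scheme) \<Rightarrow>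
   ('e \<Rightarrow> ('h, 'n) monoid_scheme) \<Rightarrow> ('e \<Rightarrow> 'h \<Rightarrow> 'g) \<Rightarrow> ('v, 'e) pre_digraph \<Rightarrow>
   (('v, 'g, 'e) generator word \<times> ('v, 'g, 'e) generator word) set" where
  "pi1_relations \<Gamma> arev VG EG \<phi> T =
     {([(Vert v g, True), (Vert v h, True)], [(Vert v (g \<otimes>\<^bsub>VG v\<^esub> h), True)]) | v g h.
        v \<in> verts \<Gamma> \<and> g \<in> carrier (VG v) \<and> h \<in> carrier (VG v)} \<union>
     {([(Stable (arev a), True)], [(Stable a, False)]) | a. a \<in> arcs \<Gamma>} \<union>
     {([(Stable a, True), (Vert (head \<Gamma> a) (\<phi> a x), True), (Stable a, False)],
       [(Vert (tail \<Gamma> a) (\<phi> (arev a) x), True)]) | a x. a \<in> arcs \<Gamma> \<and> x \<in> carrier (EG a)} \<union>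
     {([(Stable a, True)], []) | a. a \<in> arcs T}"

definition fundamental_group ::
  "('v, 'e) pre_digraph \<Rightarrow> ('e \<Rightarrow> 'e) \<Rightarrow> ('v \<Rightarrow> ('g, 'm) monoid_scheme) \<Rightarrow>
   ('e \<Rightarrow> ('h, 'n) monoid_scheme) \<Rightarrow> ('e \<Rightarrow> 'h \<Rightarrow> 'g) \<Rightarrow> ('v, 'e) pre_digraph \<Rightarrow>
   ('v, 'g, 'e) generator word set monoid" where
  "fundamental_group \<Gamma> arev VG EG \<phi> T =
    presented_group (pi1_generators \<Gamma> VG) (pi1_relations \<Gamma> arev VG EG \<phi> T)"

text \<open>The graphs of groups whose fundamental groups are the tubular groups.\<close>

locale tubular = graph_of_groups \<Gamma> arev VG EG \<phi> + fin_digraph \<Gamma>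
  for \<Gamma> :: "('v, 'e) pre_digraph" and arev :: "'e \<Rightarrow> 'e"
    and VG :: "'v \<Rightarrow> ('g, 'm) monoid_scheme"
    and EG :: "'e \<Rightarrow> ('h, 'n) monoid_scheme"
    and \<phi> :: "'e \<Rightarrow> 'h \<Rightarrow> 'g" +
  assumes connected_graph: "connected \<Gamma>"
    and vertex_group_Z2: "v \<in> verts \<Gamma> \<Longrightarrow> VG v \<cong> integer_group \<times>\<times> integer_group"
    and edge_group_Z: "a \<in> arcs \<Gamma> \<Longrightarrow> EG a \<cong> integer_group"

end

theory Submission
  imports Defs
begin

text \<open>
  Choose a homomorphism \<open>h\<close> from the tubular group \<open>G\<close> onto \<open>\<int>\<close> that does not vanish on any edge
  group; over a tree this is possible because the vertex groups can be treated one after the other.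
  The kernel of \<open>h\<close> is a vertex group of the action groupoid of \<open>G\<close> on \<open>\<int>\<close>.  This groupoid is free:
  the groupoid of each edge group is a disjoint union of \<open>\<bar>h c\<bar>\<close> trees, where \<open>c\<close> generates the edge
  group, and the groupoid of the next vertex group is obtained from these trees by adding finitely
  many free arrows.  A spanning tree then exhibits a finite basis of the kernel, and \<open>G\<close> splits as
  its semidirect product with \<open>\<int>\<close>.
\<close>

section \<open>Homomorphisms out of presented groups\<close>

text \<open>Freeness is established by a universal property instead of normal forms. Functors from
  the action groupoid to a group \<open>L\<close> correspond to homomorphisms into
  \<open>wreath L\<close> over \<open>h\<close>, so a basis of the groupoid is a generating set of
  arrows on which such homomorphisms can be prescribed at will. A locale assumption cannot range
  over types, so the test groups have type \<open>nat word set monoid\<close>; this is enough,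
  because the decisive test group is the free group on \<open>{..<n}\<close> whose map onto the
  kernel has to be injective. The vertex groups become tractable through a choice of bases
  \<open>t j\<close>, \<open>b j\<close> of \<int>^2: the edge group towards the root lies on the
  axis of \<open>t j\<close>, and each edge group away from the root has a nonzero
  \<open>t j\<close> coordinate. Then \<open>h\<close> may kill every \<open>b j\<close>, its
  nonzero values \<open>n j\<close> on \<open>t j\<close> are subject only to
  \<open>k j * n j = x j * n (u j)\<close>, and no edge group is killed.\<close>

abbreviation word_class :: "'x set \<Rightarrow> ('x word \<times> 'x word) set \<Rightarrow> 'x word \<Rightarrow> 'x word set" where
  "word_class X R w \<equiv> word_rel X R `` {w}"

definition letter_value :: "('a, 'm) monoid_scheme \<Rightarrow> ('x \<Rightarrow> 'a) \<Rightarrow> 'x \<times> bool \<Rightarrow> 'a" where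
  "letter_value L f l = (if snd l then f (fst l) else inv\<^bsub>L\<^esub> f (fst l))"

definition word_value :: "('a, 'm) monoid_scheme \<Rightarrow> ('x \<Rightarrow> 'a) \<Rightarrow> 'x word \<Rightarrow> 'a" where
  "word_value L f w = foldr (\<lambda>l g. letter_value L f l \<otimes>\<^bsub>L\<^esub> g) w \<one>\<^bsub>L\<^esub>"

lemma word_value_Nil [simp]: "word_value L f [] = \<one>\<^bsub>L\<^esub>"
  and word_value_Cons [simp]:
    "word_value L f (l # w) = letter_value L f l \<otimes>\<^bsub>L\<^esub> word_value L f w"
  by (simp_all add: word_value_def)

lemma presented_group_carrier:
  "carrier (presented_group X R) = word_class X R ` words X"
  by (auto simp: presented_group_def quotient_def)

lemma presented_group_one: "\<one>\<^bsub>presented_group X R\<^esub> = word_class X R []"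
  by (simp add: presented_group_def)

lemma word_class_closed: "w \<in> words X \<Longrightarrow> word_class X R w \<in> carrier (presented_group X R)"
  by (simp add: presented_group_carrier)

lemma word_class_eqI: "word_eq X R v w \<Longrightarrow> word_class X R v = word_class X R w"
  by (intro equiv_class_eq[OF equiv_word_rel]) (simp add: word_rel_def)

lemma word_class_relation:
  "(l, r) \<in> R \<Longrightarrow> l \<in> words X \<Longrightarrow> r \<in> words X \<Longrightarrow> word_class X R l = word_class X R r"
  using word_eq.rel[of "[]" X "[]" l r R] by (intro word_class_eqI) simp

lemma word_class_inverse_letter:
  assumes "x \<in> X"
  shows "word_class X R [(x, False)] = inv\<^bsub>presented_group X R\<^esub> word_class X R [(x, True)]"
proof -
  interpret P: group "presented_group X R" by (rule group_presented_group)
  have "word_class X R [(x, False)] \<otimes>\<^bsub>presented_group X R\<^esub> word_class X R [(x, True)]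
    = word_class X R ([(x, False)] @ [(x, True)])"
    using assms by (intro presented_group_mult) auto
  also have "\<dots> = \<one>\<^bsub>presented_group X R\<^esub>"
    using word_eq.cancel[of "[]" X "[]" x R False] assms
    by (auto intro!: word_class_eqI simp: presented_group_one)
  finally show ?thesis
    using assms by (intro P.inv_equality[symmetric]) (auto intro!: word_class_closed)
qed

context group
begin

lemma letter_value_closed [simp]:
  "f \<in> X \<rightarrow> carrier G \<Longrightarrow> fst l \<in> X \<Longrightarrow> letter_value G f l \<in> carrier G"
  by (auto simp: letter_value_def)

lemma word_value_closed [simp]:
  "f \<in> X \<rightarrow> carrier G \<Longrightarrow> w \<in> words X \<Longrightarrow> word_value G f w \<in> carrier G"
  by (induction w) auto

lemma word_value_append:
  "f \<in> X \<rightarrow> carrier G \<Longrightarrow> v \<in> words X \<Longrightarrow> w \<in> words X \<Longrightarrow>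
    word_value G f (v @ w) = word_value G f v \<otimes> word_value G f w"
  by (induction v) (auto simp: m_assoc)

lemma word_value_respects:
  assumes f: "f \<in> X \<rightarrow> carrier G"
    and R: "\<And>l r. (l, r) \<in> R \<Longrightarrow> l \<in> words X \<Longrightarrow> r \<in> words X \<Longrightarrow>
      word_value G f l = word_value G f r"
    and vw: "word_eq X R v w"
  shows "word_value G f v = word_value G f w"
  using vw
proof induction
  case (cancel u v x b)
  then have fx: "f x \<in> carrier G" using f by auto
  have "word_value G f [(x, b), (x, \<not> b)] = \<one>"
    using fx by (cases b) (simp_all add: letter_value_def)
  moreover have "word_value G f (u @ [(x, b), (x, \<not> b)] @ v)
    = word_value G f u \<otimes> (word_value G f [(x, b), (x, \<not> b)] \<otimes> word_value G f v)"
    using cancel by (subst word_value_append[OF f] | simp)+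
  ultimately show ?case
    using cancel f by (simp add: word_value_append[OF f])
next
  case (rel u v l r)
  then show ?case using R[OF rel.hyps(3-5)] by (simp add: word_value_append[OF f])
qed auto

text \<open>Von Dyck's theorem. Evaluation is constant on each class, so the value at a
  representative picked by \<open>SOME\<close> is the value at every one.\<close>

lemma presented_group_hom:
  assumes f: "f \<in> X \<rightarrow> carrier G"
    and R: "\<And>l r. (l, r) \<in> R \<Longrightarrow> l \<in> words X \<Longrightarrow> r \<in> words X \<Longrightarrow>
      word_value G f l = word_value G f r"
  obtains \<sigma> where "\<sigma> \<in> hom (presented_group X R) G"
    "\<And>w. w \<in> words X \<Longrightarrow> \<sigma> (word_class X R w) = word_value G f w"
    "\<And>x. x \<in> X \<Longrightarrow> \<sigma> (word_class X R [(x, True)]) = f x"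
proof -
  define \<sigma> where "\<sigma> A = word_value G f (SOME w. w \<in> A)" for A
  have val: "\<sigma> (word_class X R w) = word_value G f w" if w: "w \<in> words X" for w
  proof -
    have "w \<in> word_class X R w" using w by (simp add: word_rel_def word_eq.refl)
    then have "(SOME v. v \<in> word_class X R w) \<in> word_class X R w" by (rule someI)
    then have "word_eq X R w (SOME v. v \<in> word_class X R w)" by (simp add: word_rel_def)
    from word_value_respects[OF f R this] show ?thesis by (simp add: \<sigma>_def)
  qed
  have "\<sigma> \<in> hom (presented_group X R) G"
  proof (rule homI)
    show "\<sigma> A \<in> carrier G" if "A \<in> carrier (presented_group X R)" for A
      using that f by (auto simp: presented_group_carrier val)
    show "\<sigma> (A \<otimes>\<^bsub>presented_group X R\<^esub> B) = \<sigma> A \<otimes> \<sigma> B"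
      if "A \<in> carrier (presented_group X R)" "B \<in> carrier (presented_group X R)" for A B
      using that f
      by (auto simp: presented_group_carrier val presented_group_mult word_value_append[OF f])
  qed
  moreover have "\<sigma> (word_class X R [(x, True)]) = f x" if "x \<in> X" for x
    using that f funcset_mem[OF f that] by (subst val) (auto simp: letter_value_def)
  ultimately show thesis using val that by blast
qed

end

text \<open>Serves as the induction principle for presented groups: a property whose solutions form
  a subgroup has to be checked on generators only.\<close>

lemma presented_group_generated:
  assumes H: "subgroup H (presented_group X R)"
    and X: "\<And>x. x \<in> X \<Longrightarrow> word_class X R [(x, True)] \<in> H"
  shows "H = carrier (presented_group X R)"
proof
  interpret P: group "presented_group X R" by (rule group_presented_group)
  show "H \<subseteq> carrier (presented_group X R)" by (rule subgroup.subset[OF H])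
  have "word_class X R w \<in> H" if "w \<in> words X" for w
    using that
  proof (induction w)
    case Nil
    then show ?case using subgroup.one_closed[OF H] by (simp add: presented_group_one)
  next
    case (Cons l w)
    obtain x b where l: "l = (x, b)" by fastforce
    have x: "x \<in> X" "w \<in> words X" using Cons.prems l by auto
    have "word_class X R [l] \<in> H"
      using X[OF x(1)] subgroup.m_inv_closed[OF H X[OF x(1)]]
        word_class_inverse_letter[OF x(1), of R] l by (cases b) auto
    moreover have "word_class X R ([l] @ w)
        = word_class X R [l] \<otimes>\<^bsub>presented_group X R\<^esub> word_class X R w"
      using x l by (intro presented_group_mult[symmetric]) auto
    ultimately show ?case using Cons.IH[OF x(2)] subgroup.m_closed[OF H] by simp
  qed
  then show "carrier (presented_group X R) \<subseteq> H" by (auto simp: presented_group_carrier)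
qed


section \<open>Free kernels and mapping tori\<close>

text \<open>\<open>\<phi>\<close> turns \<open>\<alpha>\<close> into conjugation by
  \<open>z\<close>, and this passes to all powers by induction in both directions; the downward step
  cancels one conjugation by \<open>z\<close>.\<close>

lemma (in group) int_pow_AutoGroup_conj:
  assumes F: "group F" and \<phi>: "\<phi> \<in> hom F G" "inj_on \<phi> (carrier F)"
    and \<alpha>: "\<alpha> \<in> auto F" and z: "z \<in> carrier G"
    and conj: "\<And>w. w \<in> carrier F \<Longrightarrow> \<phi> (\<alpha> w) = z \<otimes> \<phi> w \<otimes> inv z"
    and w: "w \<in> carrier F"
  shows "(\<alpha> [^]\<^bsub>AutoGroup F\<^esub> (k::int)) w \<in> carrier F \<and>
    \<phi> ((\<alpha> [^]\<^bsub>AutoGroup F\<^esub> k) w) = z [^] k \<otimes> \<phi> w \<otimes> inv (z [^] k)"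
proof -
  interpret F: group F by fact
  interpret A: group "AutoGroup F" by (rule F.AutoGroup)
  have \<phi>_closed: "\<phi> v \<in> carrier G" if "v \<in> carrier F" for v
    using \<phi>(1) that by (auto simp: hom_def)
  have \<alpha>': "\<alpha> \<in> carrier (AutoGroup F)" using \<alpha> by (simp add: AutoGroup_def)
  have bij: "bij_betw \<alpha> (carrier F) (carrier F)" using \<alpha> by (simp add: auto_def Bij_def)
  have \<alpha>_closed: "\<alpha> v \<in> carrier F" if "v \<in> carrier F" for v
    using bij that by (auto simp: bij_betw_def)
  have aut: "\<beta> \<in> auto F" if "\<beta> \<in> carrier (AutoGroup F)" for \<beta>
    using that by (simp add: AutoGroup_def)
  have comp: "(\<beta> \<otimes>\<^bsub>AutoGroup F\<^esub> \<gamma>) v = \<beta> (\<gamma> v)"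
    if "\<beta> \<in> carrier (AutoGroup F)" "\<gamma> \<in> carrier (AutoGroup F)" "v \<in> carrier F" for \<beta> \<gamma> v
    using that aut[OF that(1)] aut[OF that(2)]
    by (simp add: AutoGroup_def BijGroup_def auto_def compose_def)
  have step: "(\<alpha> [^]\<^bsub>AutoGroup F\<^esub> (k + 1)) v = \<alpha> ((\<alpha> [^]\<^bsub>AutoGroup F\<^esub> k) v)"
    if v: "v \<in> carrier F" for k :: int and v
  proof -
    have "\<alpha> [^]\<^bsub>AutoGroup F\<^esub> (1 + k) = \<alpha> \<otimes>\<^bsub>AutoGroup F\<^esub> \<alpha> [^]\<^bsub>AutoGroup F\<^esub> k"
      using A.int_pow_mult[OF \<alpha>', of 1 k] A.int_pow_1[OF \<alpha>'] by simp
    then show ?thesis using comp[OF \<alpha>' A.int_pow_closed[OF \<alpha>'] v] by (simp add: add.commute)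
  qed
  have zstep: "z [^] (k + 1) = z \<otimes> z [^] k" for k :: int
    using int_pow_mult[OF z, of 1 k] z by (simp add: add.commute int_pow_1)
  have pow_closed: "(\<alpha> [^]\<^bsub>AutoGroup F\<^esub> k) v \<in> carrier F" if "v \<in> carrier F" for k :: int and v
    using aut[OF A.int_pow_closed[OF \<alpha>', of k]] that by (auto simp: auto_def hom_def)
  have conj_step: "\<phi> ((\<alpha> [^]\<^bsub>AutoGroup F\<^esub> (k + 1)) v)
      = z \<otimes> \<phi> ((\<alpha> [^]\<^bsub>AutoGroup F\<^esub> k) v) \<otimes> inv z" if "v \<in> carrier F" for k :: int and v
    using conj[OF pow_closed[OF that, of k]] step[OF that, of k] by simp
  have "\<phi> ((\<alpha> [^]\<^bsub>AutoGroup F\<^esub> k) w) = z [^] k \<otimes> \<phi> w \<otimes> inv (z [^] k)"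
  proof (induction k rule: int_induct[where k = 0])
    case base
    have "(\<alpha> [^]\<^bsub>AutoGroup F\<^esub> (0::int)) w = w"
      using w by (simp add: AutoGroup_def BijGroup_def)
    then show ?case using \<phi>_closed[OF w] by simp
  next
    case (step1 i)
    have "\<phi> ((\<alpha> [^]\<^bsub>AutoGroup F\<^esub> (i + 1)) w) = z \<otimes> (z [^] i \<otimes> \<phi> w \<otimes> inv (z [^] i)) \<otimes> inv z"
      using conj_step[OF w, of i] step1 by simp
    also have "\<dots> = z [^] (i + 1) \<otimes> \<phi> w \<otimes> inv (z [^] (i + 1))"
      unfolding zstep using z \<phi>_closed[OF w] by (simp add: m_assoc inv_mult_group)
    finally show ?case .
  next
    case (step2 i)
    let ?g = "\<phi> ((\<alpha> [^]\<^bsub>AutoGroup F\<^esub> (i - 1)) w)"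
    have g: "?g \<in> carrier G" using pow_closed[OF w] \<phi>_closed by blast
    have zi: "z [^] i = z \<otimes> z [^] (i - 1)" using zstep[of "i - 1"] by simp
    have "z \<otimes> ?g \<otimes> inv z = z [^] i \<otimes> \<phi> w \<otimes> inv (z [^] i)"
      using conj_step[OF w, of "i - 1"] step2 by simp
    also have "\<dots> = z \<otimes> (z [^] (i - 1) \<otimes> \<phi> w \<otimes> inv (z [^] (i - 1))) \<otimes> inv z"
      unfolding zi using z \<phi>_closed[OF w] by (simp add: m_assoc inv_mult_group)
    finally have "inv z \<otimes> (z \<otimes> ?g \<otimes> inv z) \<otimes> z =
      inv z \<otimes> (z \<otimes> (z [^] (i - 1) \<otimes> \<phi> w \<otimes> inv (z [^] (i - 1))) \<otimes> inv z) \<otimes> z" by simp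
    then show ?case using z g \<phi>_closed[OF w] by (simp add: m_assoc)
  qed
  then show ?thesis using pow_closed[OF w] by simp
qed

text \<open>The powers of \<open>z\<close> split the extension of \<int> by the kernel, so the group
  is the semidirect product for the conjugation action of these powers; \<open>\<alpha>\<close> is
  conjugation by \<open>z\<close> carried to the free group along \<open>\<phi>\<close>.\<close>

lemma free_kernel_imp_free_by_Z:
  assumes G: "group G" and h: "h \<in> hom G integer_group" and z: "z \<in> carrier G" "h z = 1"
    and \<phi>: "\<phi> \<in> hom (free_group {..<n}) G" "inj_on \<phi> (carrier (free_group {..<n::nat}))"
      "\<phi> ` carrier (free_group {..<n}) = kernel G integer_group h"
  shows "free_by_Z G"
proof -
  let ?F = "free_group {..<n}"
  interpret G: group G by fact
  interpret F: group ?F by (rule group_free_group)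
  interpret h: group_hom G integer_group h
    by (simp add: group_hom_def group_hom_axioms_def G h)
  interpret \<phi>: group_hom ?F G \<phi>
    by (simp add: group_hom_def group_hom_axioms_def G \<phi> F.is_group)
  have hpow: "h (z [^]\<^bsub>G\<^esub> k) = k" for k :: int
    using h.hom_int_pow[OF z(1), of k] z by simp
  have ker: "g \<in> \<phi> ` carrier ?F \<longleftrightarrow> g \<in> carrier G \<and> h g = 0" for g
    by (simp add: \<phi>(3) kernel_def)
  have \<phi>ker: "h (\<phi> w) = 0" if "w \<in> carrier ?F" for w using ker that by blast
  define \<psi> where "\<psi> = inv_into (carrier ?F) \<phi>"
  have \<psi>: "\<psi> g \<in> carrier ?F" "\<phi> (\<psi> g) = g" if "g \<in> carrier G" "h g = 0" for g
    using ker that unfolding \<psi>_def by (auto simp: inv_into_into f_inv_into_f)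
  have \<psi>\<phi>: "\<psi> (\<phi> w) = w" if "w \<in> carrier ?F" for w
    using that \<phi>(2) by (simp add: \<psi>_def)
  \<comment> \<open>Conjugation by \<open>y\<close>, read in the free group. The value
    \<open>undefined\<close> off the carrier is what membership in \<open>Bij\<close> requires,
    since its elements are extensional.\<close>
  define cj where "cj y w = (if w \<in> carrier ?F then \<psi> (y \<otimes>\<^bsub>G\<^esub> \<phi> w \<otimes>\<^bsub>G\<^esub> inv\<^bsub>G\<^esub> y) else undefined)"
    for y w
  have cj: "cj y w \<in> carrier ?F" "\<phi> (cj y w) = y \<otimes>\<^bsub>G\<^esub> \<phi> w \<otimes>\<^bsub>G\<^esub> inv\<^bsub>G\<^esub> y"
    if "y \<in> carrier G" "w \<in> carrier ?F" for y w
    using that \<psi>[of "y \<otimes>\<^bsub>G\<^esub> \<phi> w \<otimes>\<^bsub>G\<^esub> inv\<^bsub>G\<^esub> y"] \<phi>ker[OF that(2)] by (auto simp: cj_def)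
  have cj_inv: "cj y (cj (inv\<^bsub>G\<^esub> y) w) = w" if y: "y \<in> carrier G" and w: "w \<in> carrier ?F" for y w
  proof -
    have "\<phi> (cj y (cj (inv\<^bsub>G\<^esub> y) w)) = \<phi> w"
      using y w by (simp add: cj G.m_assoc[symmetric]) (simp add: G.m_assoc)
    then show ?thesis
      using \<phi>(2) w y by (auto simp: inj_on_def cj)
  qed
  define \<alpha> where "\<alpha> = cj z"
  have \<alpha>: "\<alpha> \<in> auto ?F"
    unfolding auto_def
  proof
    show "\<alpha> \<in> hom ?F ?F"
    proof (rule homI)
      show "\<alpha> w \<in> carrier ?F" if "w \<in> carrier ?F" for w
        using cj that z by (simp add: \<alpha>_def)
      show "\<alpha> (v \<otimes>\<^bsub>?F\<^esub> w) = \<alpha> v \<otimes>\<^bsub>?F\<^esub> \<alpha> w" if vw: "v \<in> carrier ?F" "w \<in> carrier ?F" for v w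
      proof -
        have "\<phi> (\<alpha> (v \<otimes>\<^bsub>?F\<^esub> w)) = \<phi> (\<alpha> v \<otimes>\<^bsub>?F\<^esub> \<alpha> w)"
          using vw z by (simp add: \<alpha>_def cj G.m_assoc)
            (simp add: G.m_assoc[symmetric])
        then show ?thesis
          using \<phi>(2) vw z by (auto simp: inj_on_def \<alpha>_def cj)
      qed
    qed
    have "bij_betw \<alpha> (carrier ?F) (carrier ?F)"
      by (rule bij_betw_byWitness[where f' = "cj (inv\<^bsub>G\<^esub> z)"])
        (use cj cj_inv[OF z(1)] cj_inv[of "inv\<^bsub>G\<^esub> z"] z in \<open>auto simp: \<alpha>_def\<close>)
    then show "\<alpha> \<in> Bij (carrier ?F)"
      by (auto simp: Bij_def extensional_def \<alpha>_def cj_def)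
  qed
  have pow: "(\<alpha> [^]\<^bsub>AutoGroup ?F\<^esub> k) w \<in> carrier ?F"
    "\<phi> ((\<alpha> [^]\<^bsub>AutoGroup ?F\<^esub> k) w) = z [^]\<^bsub>G\<^esub> k \<otimes>\<^bsub>G\<^esub> \<phi> w \<otimes>\<^bsub>G\<^esub> inv\<^bsub>G\<^esub> (z [^]\<^bsub>G\<^esub> k)"
    if "w \<in> carrier ?F" for k :: int and w
    using G.int_pow_AutoGroup_conj[OF F.is_group \<phi>(1,2) \<alpha> z(1) _ that] cj(2)[OF z(1)]
    by (auto simp: \<alpha>_def)
  let ?M = "mapping_torus ?F \<alpha>"
  have M: "group ?M" by (rule group_mapping_torus[OF F.is_group \<alpha>])
  define \<Phi> where "\<Phi> = (\<lambda>(w, k). \<phi> w \<otimes>\<^bsub>G\<^esub> z [^]\<^bsub>G\<^esub> (k::int))"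
  have carM: "carrier ?M = carrier ?F \<times> UNIV"
    by (simp add: mapping_torus_def semidirect_product_def)
  have "\<Phi> \<in> iso ?M G"
  proof (rule isoI)
    show "\<Phi> \<in> hom ?M G"
    proof (rule homI)
      show "\<Phi> p \<in> carrier G" if "p \<in> carrier ?M" for p
        using that z by (auto simp: carM \<Phi>_def)
      show "\<Phi> (p \<otimes>\<^bsub>?M\<^esub> q) = \<Phi> p \<otimes>\<^bsub>G\<^esub> \<Phi> q" if pq: "p \<in> carrier ?M" "q \<in> carrier ?M" for p q
      proof -
        obtain v k w l where e: "p = (v, k)" "q = (w, l)" by (metis surj_pair)
        then have vw: "v \<in> carrier ?F" "w \<in> carrier ?F" using pq by (auto simp: carM)
        have "\<Phi> (p \<otimes>\<^bsub>?M\<^esub> q) = \<phi> v \<otimes>\<^bsub>G\<^esub> (z [^]\<^bsub>G\<^esub> k \<otimes>\<^bsub>G\<^esub> \<phi> w \<otimes>\<^bsub>G\<^esub> inv\<^bsub>G\<^esub> (z [^]\<^bsub>G\<^esub> k)) \<otimes>\<^bsub>G\<^esub>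
            (z [^]\<^bsub>G\<^esub> k \<otimes>\<^bsub>G\<^esub> z [^]\<^bsub>G\<^esub> l)"
          using vw z by (simp add: e \<Phi>_def mapping_torus_def semidirect_product_def pow
              G.int_pow_mult)
        also have "\<dots> = \<Phi> p \<otimes>\<^bsub>G\<^esub> \<Phi> q"
          using vw z by (simp add: e \<Phi>_def G.m_assoc)
            (simp add: G.m_assoc[symmetric])
        finally show ?thesis .
      qed
    qed
    \<comment> \<open>Every \<open>g\<close> is in a unique way a kernel element times
      \<open>z\<close> to the power \<open>h g\<close>.\<close>
    show "bij_betw \<Phi> (carrier ?M) (carrier G)"
    proof (rule bij_betw_byWitness[where f' = "\<lambda>g. (\<psi> (g \<otimes>\<^bsub>G\<^esub> inv\<^bsub>G\<^esub> (z [^]\<^bsub>G\<^esub> h g)), h g)"])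
      have h\<Phi>: "h (\<Phi> (w, k)) = k" if "w \<in> carrier ?F" for w k
        using that z by (simp add: \<Phi>_def \<phi>ker hpow)
      show "\<forall>p\<in>carrier ?M. (\<psi> (\<Phi> p \<otimes>\<^bsub>G\<^esub> inv\<^bsub>G\<^esub> (z [^]\<^bsub>G\<^esub> h (\<Phi> p))), h (\<Phi> p)) = p"
        using z by (clarsimp simp: carM h\<Phi>) (simp add: \<Phi>_def G.m_assoc \<psi>\<phi>)
      have mem: "g \<otimes>\<^bsub>G\<^esub> inv\<^bsub>G\<^esub> (z [^]\<^bsub>G\<^esub> h g) \<in> carrier G" "h (g \<otimes>\<^bsub>G\<^esub> inv\<^bsub>G\<^esub> (z [^]\<^bsub>G\<^esub> h g)) = 0"
        if "g \<in> carrier G" for g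
        using that z by (auto simp: hpow)
      show "\<forall>g\<in>carrier G. \<Phi> (\<psi> (g \<otimes>\<^bsub>G\<^esub> inv\<^bsub>G\<^esub> (z [^]\<^bsub>G\<^esub> h g)), h g) = g"
        using z by (auto simp: \<Phi>_def \<psi>[OF mem] G.m_assoc)
      show "\<Phi> ` carrier ?M \<subseteq> carrier G" using z by (auto simp: carM \<Phi>_def)
      show "(\<lambda>g. (\<psi> (g \<otimes>\<^bsub>G\<^esub> inv\<^bsub>G\<^esub> (z [^]\<^bsub>G\<^esub> h g)), h g)) ` carrier G \<subseteq> carrier ?M"
        using \<psi>[OF mem] by (auto simp: carM)
    qed
  qed
  then have "?M \<cong> G" by (auto simp: is_iso_def)
  then have "G \<cong> ?M" by (rule group.iso_sym[OF M])
  then show ?thesis using \<alpha> by (auto simp: free_by_Z_def)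
qed


section \<open>Cocycles as homomorphisms into a wreath product\<close>

text \<open>
  A homomorphism \<open>\<sigma>\<close> from \<open>G\<close> to \<open>wreath L = L\<^sup>\<int> \<rtimes> \<int>\<close> over \<open>h : G \<rightarrow> \<int>\<close> is the same thing as a functor
  to \<open>L\<close> from the action groupoid of \<open>G\<close> on \<open>\<int>\<close>, in which \<open>(g, i)\<close> is an arrow from \<open>i\<close> to \<open>i + h g\<close>:
  the functor sends this arrow to \<open>fst (\<sigma> g) i\<close>.
\<close>

definition wreath :: "('a, 'm) monoid_scheme \<Rightarrow> ((int \<Rightarrow> 'a) \<times> int) monoid" where
  "wreath L =
    \<lparr>carrier = (UNIV \<rightarrow> carrier L) \<times> UNIV,
     monoid.mult = \<lambda>(f, a) (g, b). (\<lambda>i. f (i + b) \<otimes>\<^bsub>L\<^esub> g i, a + b),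
     one = (\<lambda>_. \<one>\<^bsub>L\<^esub>, 0)\<rparr>"

lemma wreath_mult:
  "x \<otimes>\<^bsub>wreath L\<^esub> y = (\<lambda>i. fst x (i + snd y) \<otimes>\<^bsub>L\<^esub> fst y i, snd x + snd y)"
  by (simp add: wreath_def split: prod.split)

lemma wreath_one: "\<one>\<^bsub>wreath L\<^esub> = (\<lambda>_. \<one>\<^bsub>L\<^esub>, 0)"
  by (simp add: wreath_def)

lemma wreath_carrier: "x \<in> carrier (wreath L) \<longleftrightarrow> (\<forall>i. fst x i \<in> carrier L)"
  by (cases x) (auto simp: wreath_def)

lemma (in group) group_wreath: "group (wreath G)"
proof (rule groupI)
  show "\<exists>y\<in>carrier (wreath G). y \<otimes>\<^bsub>wreath G\<^esub> x = \<one>\<^bsub>wreath G\<^esub>" if "x \<in> carrier (wreath G)" for x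
    using that
    by (intro bexI[of _ "(\<lambda>i. inv (fst x (i - snd x)), - snd x)"])
      (auto simp: wreath_mult wreath_one wreath_carrier)
qed (auto simp: wreath_mult wreath_one wreath_carrier m_assoc algebra_simps fun_eq_iff
    intro: prod_eqI)

lemma wreath_snd_hom: "group L \<Longrightarrow> snd \<in> hom (wreath L) integer_group"
  by (rule homI) (auto simp: wreath_mult)

lemma (in group) wreath_snd_int_pow:
  assumes "x \<in> carrier (wreath G)"
  shows "snd (x [^]\<^bsub>wreath G\<^esub> (k::int)) = k * snd x"
proof -
  interpret snd: group_hom "wreath G" integer_group snd
    by (simp add: group_hom_def group_hom_axioms_def group_wreath wreath_snd_hom[OF is_group])
  show ?thesis using snd.hom_int_pow[OF assms, of k] by simp
qed

text \<open>The subgroupoid on all objects generated by \<open>A\<close>. The pair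
  \<open>(x, i)\<close> is an arrow from \<open>i\<close> to \<open>i + h x\<close>, so in
  \<open>comp\<close> the arrow of \<open>y\<close> starts where that of \<open>x\<close> ends, and
  the later factor stands on the left.\<close>

inductive_set arrows :: "('a, 'm) monoid_scheme \<Rightarrow> ('a \<Rightarrow> int) \<Rightarrow> ('a \<times> int) set \<Rightarrow> ('a \<times> int) set"
  for G h A where
  unit: "(\<one>\<^bsub>G\<^esub>, i) \<in> arrows G h A"
| arc: "(x, i) \<in> A \<Longrightarrow> (x, i) \<in> arrows G h A"
| comp: "(x, i) \<in> arrows G h A \<Longrightarrow> (y, i + h x) \<in> arrows G h A \<Longrightarrow> (y \<otimes>\<^bsub>G\<^esub> x, i) \<in> arrows G h A"
| inverse: "(x, i) \<in> arrows G h A \<Longrightarrow> (inv\<^bsub>G\<^esub> x, i + h x) \<in> arrows G h A"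

lemma arrows_mono: "A \<subseteq> B \<Longrightarrow> (x, i) \<in> arrows G h A \<Longrightarrow> (x, i) \<in> arrows G h B"
  by (erule arrows.induct) (auto intro: arrows.intros)

lemma (in group) arrows_carrier:
  "(x, i) \<in> arrows G h A \<Longrightarrow> A \<subseteq> carrier G \<times> UNIV \<Longrightarrow> x \<in> carrier G"
  by (induction rule: arrows.induct) auto

text \<open>Reduces generation of the whole groupoid to generators of \<open>G\<close>. The arrow of
  \<open>inv x\<close> at \<open>i\<close> is the inverse of the arrow of \<open>x\<close> at
  \<open>i - h x\<close>.\<close>

lemma subgroup_full_arrows:
  assumes "group_hom G integer_group h"
  shows "subgroup {x \<in> carrier G. \<forall>i. (x, i) \<in> arrows G h A} G"
proof -
  interpret group_hom G integer_group h by fact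
  show ?thesis
  proof (rule G.subgroupI)
    show "{x \<in> carrier G. \<forall>i. (x, i) \<in> arrows G h A} \<noteq> {}"
      by (auto intro: arrows.unit exI[of _ "\<one>\<^bsub>G\<^esub>"])
    show "inv\<^bsub>G\<^esub> x \<in> {x \<in> carrier G. \<forall>i. (x, i) \<in> arrows G h A}"
      if x: "x \<in> {x \<in> carrier G. \<forall>i. (x, i) \<in> arrows G h A}" for x
    proof -
      have "(inv\<^bsub>G\<^esub> x, i) \<in> arrows G h A" for i
        using arrows.inverse[of x "i - h x" G h A] x by simp
      then show ?thesis using x by auto
    qed
  qed (auto intro: arrows.comp)
qed


section \<open>Vertex groups of free action groupoids\<close>

text \<open>\<open>generating\<close> and \<open>free\<close> together say that the arrows
  \<open>(t0, i)\<close> for all \<open>i\<close> and \<open>(arc q, start q)\<close> for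
  \<open>q\<close> in \<open>I\<close> form a basis. Since \<open>h t0 \<noteq> 0\<close>, the
  \<open>t0\<close>-arrows form lines, one for each residue class modulo \<open>h t0\<close>. They
  belong to every tree considered below, hence \<open>free\<close> only prescribes the value one on
  them.\<close>

locale free_action_groupoid = group_hom G integer_group h
  for G :: "('a, 'm) monoid_scheme" (structure) and h :: "'a \<Rightarrow> int" +
  fixes t0 :: 'a and I :: "'i set" and arc :: "'i \<Rightarrow> 'a" and start :: "'i \<Rightarrow> int"
  assumes finite_index: "finite I"
    and root: "t0 \<in> carrier G" "h t0 \<noteq> 0"
    and arc_closed: "q \<in> I \<Longrightarrow> arc q \<in> carrier G"
    and surjective: "\<exists>z\<in>carrier G. h z = 1"
    and generating: "x \<in> carrier G \<Longrightarrow>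
      (x, i) \<in> arrows G h ((\<lambda>q. (arc q, start q)) ` I \<union> {t0} \<times> UNIV)"
    and free: "\<And>(L :: nat word set monoid) \<rho>. group L \<Longrightarrow> (\<And>q. q \<in> I \<Longrightarrow> \<rho> q \<in> carrier L) \<Longrightarrow>
      \<exists>\<sigma>\<in>hom G (wreath L). (\<forall>x\<in>carrier G. snd (\<sigma> x) = h x) \<and> (\<forall>i. fst (\<sigma> t0) i = \<one>\<^bsub>L\<^esub>) \<and>
        (\<forall>q\<in>I. fst (\<sigma> (arc q)) (start q) = \<rho> q)"
begin

section \<open>Spanning trees of the action groupoid\<close>

definition arcs_over :: "'i set \<Rightarrow> ('a \<times> int) set" where
  "arcs_over J = (\<lambda>q. (arc q, start q)) ` J \<union> {t0} \<times> UNIV"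

definition target :: "'i \<Rightarrow> int" where
  "target q = start q + h (arc q)"

lemma arcs_over_carrier: "J \<subseteq> I \<Longrightarrow> arcs_over J \<subseteq> carrier G \<times> UNIV"
  using root arc_closed by (auto simp: arcs_over_def)

lemma root_pow_arrow: "(t0 [^] (k::int), i) \<in> arrows G h (arcs_over J)"
proof -
  have "t0 \<in> {x \<in> carrier G. \<forall>i. (x, i) \<in> arrows G h (arcs_over J)}"
    using root by (auto simp: arcs_over_def intro: arrows.arc)
  from G.subgroup_int_pow_closed[OF subgroup_full_arrows[OF group_hom_axioms] this] show ?thesis by blast
qed

text \<open>\<open>S\<close> is the vertex set of a partial tree, a union of
  \<open>t0\<close>-lines; \<open>J\<close> lists its further arcs, and \<open>\<tau> i\<close> is
  the product along the tree path from \<open>0\<close> to \<open>i\<close>. In place of acyclicity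
  stands the consistency of this potential along each arc of the tree.\<close>

definition tree_on :: "int set \<Rightarrow> 'i set \<Rightarrow> (int \<Rightarrow> 'a) \<Rightarrow> bool" where
  "tree_on S J \<tau> \<longleftrightarrow> 0 \<in> S \<and> (\<forall>i. i + h t0 \<in> S \<longleftrightarrow> i \<in> S) \<and> J \<subseteq> I \<and> \<tau> 0 = \<one> \<and>
    (\<forall>i\<in>S. \<tau> i \<in> carrier G \<and> h (\<tau> i) = i \<and> (\<tau> i, 0) \<in> arrows G h (arcs_over J) \<and>
      \<tau> (i + h t0) = t0 \<otimes> \<tau> i) \<and>
    (\<forall>q\<in>J. start q \<in> S \<and> target q \<in> S \<and> \<tau> (target q) = arc q \<otimes> \<tau> (start q))"

lemma periodic_add_mult:
  assumes "\<And>i. i + n \<in> S \<longleftrightarrow> i \<in> S"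
  shows "i + k * n \<in> S \<longleftrightarrow> (i::int) \<in> S"
proof (induction k rule: int_induct[where k = 0])
  case (step1 k)
  then show ?case using assms[of "i + k * n"] by (simp add: algebra_simps)
next
  case (step2 k)
  then show ?case using assms[of "i + (k - 1) * n"] by (simp add: algebra_simps)
qed simp

lemma root_pow_add_one: "t0 [^] (k + 1 :: int) = t0 \<otimes> t0 [^] k"
  using G.int_pow_mult[OF root(1), of 1 k] G.int_pow_1[OF root(1)] by (simp add: add.commute)

text \<open>An arc with exactly one end in \<open>S\<close> attaches the entire
  \<open>t0\<close>-line through its other end.\<close>

lemma tree_on_extend:
  assumes T: "tree_on S J \<tau>" and q: "q \<in> I" and cross: "start q \<in> S \<longleftrightarrow> target q \<notin> S"
  shows "\<exists>S' J' \<tau>'. tree_on S' J' \<tau>' \<and> S \<subset> S'"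
proof -
  define n0 where "n0 = h t0"
  have n0: "n0 \<noteq> 0" using root by (simp add: n0_def)
  have per: "i + k * n0 \<in> S \<longleftrightarrow> i \<in> S" for i k
    using T by (intro periodic_add_mult) (simp add: tree_on_def n0_def)
  have \<tau>: "\<tau> i \<in> carrier G" "h (\<tau> i) = i" "(\<tau> i, 0) \<in> arrows G h (arcs_over J)"
    "\<tau> (i + n0) = t0 \<otimes> \<tau> i" if "i \<in> S" for i
    using T that by (auto simp: tree_on_def n0_def)
  \<comment> \<open>\<open>w\<close> is the end outside \<open>S\<close>, and
    \<open>\<gamma>\<close> the path from \<open>0\<close> to it that finishes with the arc or its
    inverse.\<close>
  define w where "w = (if start q \<in> S then target q else start q)"
  define \<gamma> where "\<gamma> = (if start q \<in> S then arc q \<otimes> \<tau> (start q) else inv (arc q) \<otimes> \<tau> (target q))"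
  have w: "w \<notin> S" using cross by (auto simp: w_def)
  have mono: "(x, i) \<in> arrows G h (arcs_over (insert q J))"
    if "(x, i) \<in> arrows G h (arcs_over J)" for x i
    by (rule arrows_mono[OF _ that]) (auto simp: arcs_over_def)
  have q_arrow: "(arc q, start q) \<in> arrows G h (arcs_over (insert q J))"
    by (rule arrows.arc) (simp add: arcs_over_def)
  have \<gamma>: "\<gamma> \<in> carrier G" "h \<gamma> = w" "(\<gamma>, 0) \<in> arrows G h (arcs_over (insert q J))"
  proof -
    consider "start q \<in> S" | "start q \<notin> S" "target q \<in> S" using cross by blast
    then have "\<gamma> \<in> carrier G \<and> h \<gamma> = w \<and> (\<gamma>, 0) \<in> arrows G h (arcs_over (insert q J))"
    proof cases
      case 1
      then show ?thesis
        using \<tau>[OF 1] arc_closed[OF q] q_arrow mono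
        by (auto simp: \<gamma>_def w_def target_def intro!: arrows.comp)
    next
      case 2
      then show ?thesis
        using \<tau>[OF 2(2)] arc_closed[OF q] arrows.inverse[OF q_arrow] mono
        by (auto simp: \<gamma>_def w_def target_def intro!: arrows.comp)
    qed
    then show "\<gamma> \<in> carrier G" "h \<gamma> = w" "(\<gamma>, 0) \<in> arrows G h (arcs_over (insert q J))" by auto
  qed
  define S' where "S' = S \<union> {i. n0 dvd i - w}"
  \<comment> \<open>On the new line the potential at \<open>w\<close> is continued by powers of
    \<open>t0\<close>, each factor moving by \<open>n0\<close>.\<close>
  define \<tau>' where "\<tau>' i = (if i \<in> S then \<tau> i else t0 [^] ((i - w) div n0) \<otimes> \<gamma>)" for i
  have disj: "i \<notin> S" if d: "n0 dvd i - w" for i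
  proof -
    obtain k where "i - w = n0 * k" using d by (elim dvdE)
    then have "i = w + k * n0" by (simp add: algebra_simps)
    then show ?thesis using per[of w k] w by simp
  qed
  have shift: "n0 dvd i + n0 - w \<longleftrightarrow> n0 dvd i - w" for i
    by (metis diff_add_eq dvd_add_triv_right_iff)
  have \<tau>'S: "\<tau>' i = \<tau> i" if "i \<in> S" for i using that by (simp add: \<tau>'_def)
  have \<tau>'w: "\<tau>' w = \<gamma>" using w \<gamma> by (simp add: \<tau>'_def)
  have arc_q: "\<tau>' (target q) = arc q \<otimes> \<tau>' (start q)"
  proof (cases "start q \<in> S")
    case True
    then show ?thesis using \<tau>'w \<tau>'S[OF True] by (simp add: \<gamma>_def w_def)
  next
    case False
    then have "target q \<in> S" using cross by blast
    then show ?thesis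
      using \<tau>'w \<tau>'S \<tau> False arc_closed[OF q] by (simp add: \<gamma>_def w_def G.m_assoc[symmetric])
  qed
  have "\<tau>' i \<in> carrier G \<and> h (\<tau>' i) = i \<and> (\<tau>' i, 0) \<in> arrows G h (arcs_over (insert q J)) \<and>
      \<tau>' (i + n0) = t0 \<otimes> \<tau>' i" if i: "i \<in> S'" for i
  proof (cases "i \<in> S")
    case True
    then show ?thesis using \<tau>[OF True] mono per[of i 1] by (simp add: \<tau>'_def)
  next
    case False
    then have d: "n0 dvd i - w" using i by (simp add: S'_def)
    then have d': "n0 dvd (i + n0) - w" by (simp add: shift)
    have "(i + n0 - w) div n0 = (i - w) div n0 + 1"
      using n0 by (metis add_diff_eq diff_add_eq div_add_self2)
    then have "\<tau>' (i + n0) = t0 \<otimes> \<tau>' i"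
      using False disj[OF d'] \<gamma> root by (simp add: \<tau>'_def root_pow_add_one G.m_assoc)
    moreover have "h (\<tau>' i) = i"
      using False d \<gamma> root hom_int_pow[OF root(1)] by (simp add: \<tau>'_def n0_def)
    ultimately show ?thesis
      using False \<gamma> root by (auto simp: \<tau>'_def intro!: arrows.comp root_pow_arrow)
  qed
  moreover have "i + n0 \<in> S' \<longleftrightarrow> i \<in> S'" for i
    using per[of i 1] by (simp add: S'_def shift)
  moreover have "start q \<in> S'" "target q \<in> S'"
    using cross by (auto simp: S'_def w_def)
  moreover have "start p \<in> S' \<and> target p \<in> S' \<and> \<tau>' (target p) = arc p \<otimes> \<tau>' (start p)"
    if "p \<in> J" for p
    using T that \<tau>'S by (simp add: tree_on_def S'_def)
  moreover have "0 \<in> S'" "J \<subseteq> I" "\<tau>' 0 = \<one>"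
    using T \<tau>'S[of 0] by (auto simp: tree_on_def S'_def)
  ultimately have "tree_on S' (insert q J) \<tau>'"
    unfolding tree_on_def n0_def[symmetric] using q arc_q by simp
  moreover have "S \<subset> S'" using w by (auto simp: S'_def)
  ultimately show ?thesis by blast
qed

text \<open>Otherwise every arrow would preserve \<open>S\<close>, whereas the powers of an element
  of height one join \<open>0\<close> to every integer.\<close>

lemma tree_on_crossing:
  assumes T: "tree_on S J \<tau>" and S: "S \<noteq> UNIV"
  shows "\<exists>q\<in>I. start q \<in> S \<longleftrightarrow> target q \<notin> S"
proof (rule ccontr)
  assume no: "\<not> ?thesis"
  have stable: "i + h x \<in> S \<longleftrightarrow> i \<in> S" if "(x, i) \<in> arrows G h (arcs_over I)" for x i
    using that
  proof induction
    case (arc x i)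
    then show ?case using no T by (auto simp: arcs_over_def target_def tree_on_def)
  next
    case (comp x i y)
    then have "x \<in> carrier G" "y \<in> carrier G"
      using G.arrows_carrier arcs_over_carrier by blast+
    then show ?case using comp by (simp add: algebra_simps)
  next
    case (inverse x i)
    then have "x \<in> carrier G" using G.arrows_carrier arcs_over_carrier by blast
    then show ?case using inverse by simp
  qed simp
  obtain z where z: "z \<in> carrier G" "h z = 1" using surjective by blast
  have "i \<in> S" for i
  proof -
    have "(z [^] i, 0) \<in> arrows G h (arcs_over I)"
      using generating z by (simp add: arcs_over_def)
    moreover have "h (z [^] i) = i" using hom_int_pow[OF z(1), of i] z by simp
    ultimately show ?thesis using stable[of "z [^] i" 0] T by (simp add: tree_on_def)
  qed
  then show False using S by blast
qed

text \<open>Growing stops because \<open>S\<close> is a union of residue classes modulo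
  \<open>\<bar>h t0\<bar>\<close>, of which there are finitely many; the start is the
  \<open>t0\<close>-line through \<open>0\<close>.\<close>

lemma spanning_tree: "\<exists>J \<tau>. tree_on UNIV J \<tau>"
proof -
  define n0 where "n0 = h t0"
  have n0: "n0 \<noteq> 0" using root by (simp add: n0_def)
  have grow: "tree_on S J \<tau> \<Longrightarrow> \<exists>J \<tau>. tree_on UNIV J \<tau>" for S J \<tau>
  proof (induction "card ({0..<\<bar>n0\<bar>} - S)" arbitrary: S J \<tau> rule: less_induct)
    case less
    show ?case
    proof (cases "S = UNIV")
      case False
      from tree_on_crossing[OF less.prems False] obtain q
        where "q \<in> I" "start q \<in> S \<longleftrightarrow> target q \<notin> S" by blast
      from tree_on_extend[OF less.prems this] obtain S' J' \<tau>'
        where T': "tree_on S' J' \<tau>'" and sub: "S \<subset> S'" by blast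
      have per: "i mod \<bar>n0\<bar> \<in> X \<longleftrightarrow> i \<in> X" if "tree_on X Y \<upsilon>" for i X Y \<upsilon>
      proof -
        have e: "i mod \<bar>n0\<bar> + (i div \<bar>n0\<bar> * sgn n0) * n0 = i"
        proof -
          have "sgn n0 * n0 = \<bar>n0\<bar>" by (simp add: sgn_if abs_if)
          then show ?thesis by (simp add: mult.assoc)
        qed
        show ?thesis
          using periodic_add_mult[of n0 X "i mod \<bar>n0\<bar>" "i div \<bar>n0\<bar> * sgn n0"] that
          by (simp add: tree_on_def n0_def[symmetric] e)
      qed
      obtain w where "w \<in> S' - S" using sub by blast
      then have "w mod \<bar>n0\<bar> \<in> ({0..<\<bar>n0\<bar>} - S) - ({0..<\<bar>n0\<bar>} - S')"
        using per[OF T'] per[OF less.prems] n0 by auto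
      then have "{0..<\<bar>n0\<bar>} - S' \<subset> {0..<\<bar>n0\<bar>} - S" using sub by blast
      then have "card ({0..<\<bar>n0\<bar>} - S') < card ({0..<\<bar>n0\<bar>} - S)"
        by (intro psubset_card_mono) auto
      from less.hyps[OF this T'] show ?thesis .
    qed (use less.prems in blast)
  qed
  have div: "(i + n0) div n0 = i div n0 + 1" for i
    using n0 by simp
  have "tree_on {i. n0 dvd i} {} (\<lambda>i. t0 [^] (i div n0))"
    using root hom_int_pow[OF root(1)] root_pow_arrow[of _ 0]
    by (auto simp: tree_on_def n0_def[symmetric] div root_pow_add_one)
  then show ?thesis by (rule grow)
qed

text \<open>Each arc outside a spanning tree closes up to a loop at \<open>0\<close>, and these
  loops are a basis of the vertex group. That they generate comes from \<open>generating\<close>;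
  that they are independent, from \<open>free\<close> with the free group itself as the group of
  values.\<close>

theorem kernel_free:
  "\<exists>n::nat. \<exists>\<phi>\<in>hom (free_group {..<n}) G. inj_on \<phi> (carrier (free_group {..<n})) \<and>
    \<phi> ` carrier (free_group {..<n}) = kernel G integer_group h"
proof -
  obtain J \<tau> where T: "tree_on UNIV J \<tau>" using spanning_tree by blast
  have J: "J \<subseteq> I" and \<tau>0: "\<tau> 0 = \<one>" using T by (auto simp: tree_on_def)
  have \<tau>: "\<tau> i \<in> carrier G" "h (\<tau> i) = i" "(\<tau> i, 0) \<in> arrows G h (arcs_over J)"
    "\<tau> (i + h t0) = t0 \<otimes> \<tau> i" for i
    using T by (auto simp: tree_on_def)
  have \<tau>J: "\<tau> (target q) = arc q \<otimes> \<tau> (start q)" if "q \<in> J" for q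
    using T that by (auto simp: tree_on_def)
  define n where "n = card (I - J)"
  obtain e where e: "bij_betw e {..<n} (I - J)"
    using ex_bij_betw_nat_finite[of "I - J"] finite_index by (auto simp: n_def atLeast0LessThan)
  define F where "F = free_group {..<n}"
  \<comment> \<open>The loop at \<open>0\<close>: along the tree to the start of \<open>q\<close>,
    over \<open>q\<close>, and back along the tree.\<close>
  define X where "X q = inv (\<tau> (target q)) \<otimes> arc q \<otimes> \<tau> (start q)" for q
  have X: "X q \<in> carrier G" "h (X q) = 0" if "q \<in> I" for q
    using \<tau> arc_closed[OF that] by (auto simp: X_def target_def)
  interpret F: group F unfolding F_def by (rule group_free_group)
  have eI: "e l \<in> I" if "l < n" for l using e that by (auto simp: bij_betw_def)
  obtain \<phi> where \<phi>: "\<phi> \<in> hom F G"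
    "\<And>l. l \<in> {..<n} \<Longrightarrow> \<phi> (word_class {..<n} {} [(l, True)]) = X (e l)"
  proof -
    have "(\<lambda>l. X (e l)) \<in> {..<n} \<rightarrow> carrier G" using X eI by auto
    then have "\<exists>\<phi>. \<phi> \<in> hom F G \<and> (\<forall>l\<in>{..<n}. \<phi> (word_class {..<n} {} [(l, True)]) = X (e l))"
      unfolding F_def free_group_def by (rule G.presented_group_hom[where R = "{}"]; blast)
    then show thesis using that by blast
  qed
  interpret \<phi>: group_hom F G \<phi>
    by (simp add: group_hom_def group_hom_axioms_def \<phi> G.is_group F.is_group)
  define K where "K = kernel G integer_group h"
  have sub_K: "subgroup K G" unfolding K_def by (rule subgroup_kernel)
  have img: "subgroup (\<phi> ` carrier F) G" by (rule \<phi>.img_is_subgroup)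

  have "\<phi> ` carrier F = K"
  proof
    have "subgroup {w \<in> carrier F. \<phi> w \<in> K} F"
      by (rule F.subgroupI)
        (use \<phi>.hom_closed subgroup.one_closed[OF sub_K] subgroup.m_closed[OF sub_K]
          subgroup.m_inv_closed[OF sub_K] in \<open>auto intro!: exI[of _ "\<one>\<^bsub>F\<^esub>"]\<close>)
    moreover have "word_class {..<n} {} [(l, True)] \<in> {w \<in> carrier F. \<phi> w \<in> K}" if "l \<in> {..<n}" for l
      using that \<phi>(2)[OF that] X[OF eI]
      by (auto simp: F_def free_group_def K_def kernel_def intro!: word_class_closed)
    ultimately have "{w \<in> carrier F. \<phi> w \<in> K} = carrier F"
      unfolding F_def free_group_def by (intro presented_group_generated) auto
    then show "\<phi> ` carrier F \<subseteq> K" by blast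
  next
    \<comment> \<open>Every arrow, closed up through the tree, is a product of basic loops and their
      inverses. For an element of the kernel at \<open>0\<close> both tree paths are trivial, so
      closing up changes nothing.\<close>
    have conj: "inv (\<tau> (i + h x)) \<otimes> x \<otimes> \<tau> i \<in> \<phi> ` carrier F"
      if "(x, i) \<in> arrows G h (arcs_over I)" for x i
      using that
    proof induction
      case (unit i)
      then show ?case using \<tau> subgroup.one_closed[OF img] by simp
    next
      case (arc x i)
      then consider "x = t0" | q where "q \<in> J" "x = arc q" "i = start q"
        | q where "q \<in> I - J" "x = arc q" "i = start q"
        by (auto simp: arcs_over_def)
      then show ?case
      proof cases
        case 1
        then show ?thesis using \<tau> root subgroup.one_closed[OF img] by (simp add: G.m_assoc)
      next
        case 2
        then have "inv (\<tau> (i + h x)) \<otimes> x \<otimes> \<tau> i = \<one>"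
          using \<tau>J[OF 2(1)] \<tau> arc_closed J by (auto simp: target_def G.m_assoc)
        then show ?thesis using subgroup.one_closed[OF img] by simp
      next
        case 3
        then have "q \<in> e ` {..<n}" using e by (simp add: bij_betw_def)
        then obtain l where l: "l \<in> {..<n}" "e l = q" by blast
        have "inv (\<tau> (i + h x)) \<otimes> x \<otimes> \<tau> i = \<phi> (word_class {..<n} {} [(l, True)])"
          using 3 \<phi>(2)[OF l(1)] l(2) by (simp add: X_def target_def)
        then show ?thesis
          using l(1) by (auto simp: F_def free_group_def intro!: imageI word_class_closed)
      qed
    next
      case (comp x i y)
      then have xy: "x \<in> carrier G" "y \<in> carrier G"
        using G.arrows_carrier arcs_over_carrier by blast+
      have cancel: "\<tau> (i + h x) \<otimes> (inv (\<tau> (i + h x)) \<otimes> (x \<otimes> \<tau> i)) = x \<otimes> \<tau> i"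
        using xy \<tau> by (subst G.m_assoc[symmetric]) auto
      have "(inv (\<tau> (i + h x + h y)) \<otimes> y \<otimes> \<tau> (i + h x)) \<otimes> (inv (\<tau> (i + h x)) \<otimes> x \<otimes> \<tau> i)
          = inv (\<tau> (i + h x + h y)) \<otimes> (y \<otimes> x) \<otimes> \<tau> i"
        using xy \<tau> by (simp add: G.m_assoc cancel)
      also have "\<dots> = inv (\<tau> (i + h (y \<otimes> x))) \<otimes> (y \<otimes> x) \<otimes> \<tau> i"
        using xy \<tau> by (simp add: algebra_simps)
      finally show ?case using subgroup.m_closed[OF img comp.IH(2,1)] by simp
    next
      case (inverse x i)
      then have x: "x \<in> carrier G" using G.arrows_carrier arcs_over_carrier by blast
      have "inv (inv (\<tau> (i + h x)) \<otimes> x \<otimes> \<tau> i) = inv (\<tau> i) \<otimes> inv x \<otimes> \<tau> (i + h x)"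
        using x \<tau> by (simp add: G.inv_mult_group G.m_assoc)
      then show ?case using subgroup.m_inv_closed[OF img inverse.IH] x by simp
    qed
    show "K \<subseteq> \<phi> ` carrier F"
    proof
      fix x assume "x \<in> K"
      then have x: "x \<in> carrier G" "h x = 0" by (auto simp: K_def kernel_def)
      then show "x \<in> \<phi> ` carrier F"
        using conj[of x 0] generating[of x 0] \<tau>0 by (simp add: arcs_over_def)
    qed
  qed

  moreover have "inj_on \<phi> (carrier F)"
  proof -
    \<comment> \<open>Tree arcs go to one and every other arc to its own free generator.\<close>
    define \<rho> where "\<rho> q = (if q \<in> J then \<one>\<^bsub>F\<^esub> else word_class {..<n} {} [(inv_into {..<n} e q, True)])" for q
    have \<rho>_closed: "\<rho> q \<in> carrier F" if "q \<in> I" for q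
    proof (cases "q \<in> J")
      case False
      then have "inv_into {..<n} e q \<in> {..<n}"
        using that e by (intro inv_into_into) (auto simp: bij_betw_def)
      then show ?thesis
        using False by (auto simp: \<rho>_def F_def free_group_def intro!: word_class_closed)
    qed (simp add: \<rho>_def)
    obtain \<sigma> where \<sigma>: "\<sigma> \<in> hom G (wreath F)" "\<And>x. x \<in> carrier G \<Longrightarrow> snd (\<sigma> x) = h x"
      "\<And>i. fst (\<sigma> t0) i = \<one>\<^bsub>F\<^esub>" "\<And>q. q \<in> I \<Longrightarrow> fst (\<sigma> (arc q)) (start q) = \<rho> q"
      using free[of F \<rho>, OF F.is_group \<rho>_closed] by blast
    interpret \<sigma>: group_hom G "wreath F" \<sigma>
      by (simp add: group_hom_def group_hom_axioms_def \<sigma> G.is_group F.group_wreath)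
    have \<sigma>_closed: "fst (\<sigma> x) i \<in> carrier F" if "x \<in> carrier G" for x i
      using \<sigma>.hom_closed[OF that] by (simp add: wreath_carrier)
    have \<sigma>_mult: "fst (\<sigma> (y \<otimes> x)) i = fst (\<sigma> y) (i + h x) \<otimes>\<^bsub>F\<^esub> fst (\<sigma> x) i"
      if "x \<in> carrier G" "y \<in> carrier G" for x y i
      using that by (simp add: wreath_mult \<sigma>(2))
    have \<sigma>_one: "fst (\<sigma> \<one>) i = \<one>\<^bsub>F\<^esub>" for i
      by (simp add: wreath_one)
    have \<sigma>_inv: "fst (\<sigma> (inv x)) (i + h x) = inv\<^bsub>F\<^esub> fst (\<sigma> x) i" if "x \<in> carrier G" for x i
    proof -
      have "fst (\<sigma> (inv x)) (i + h x) \<otimes>\<^bsub>F\<^esub> fst (\<sigma> x) i = \<one>\<^bsub>F\<^esub>"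
        using \<sigma>_mult[of x "inv x" i] \<sigma>_one that by (simp del: \<sigma>.hom_mult)
      then show ?thesis using \<sigma>_closed that by (intro F.inv_equality[symmetric]) (auto simp del: \<sigma>.hom_inv)
    qed
    \<comment> \<open>The functor is trivial on the tree, so of the loop \<open>X q\<close> it sees
      only the arc \<open>q\<close>.\<close>
    have trivial: "fst (\<sigma> x) i = \<one>\<^bsub>F\<^esub>" if "(x, i) \<in> arrows G h (arcs_over J)" for x i
      using that
    proof induction
      case (arc x i)
      then show ?case using \<sigma>(3,4) J by (auto simp: arcs_over_def \<rho>_def)
    next
      case (comp x i y)
      then have "x \<in> carrier G" "y \<in> carrier G"
        using G.arrows_carrier arcs_over_carrier[OF J] by blast+
      then show ?case using comp \<sigma>_mult by simp
    next
      case (inverse x i)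
      then have "x \<in> carrier G" using G.arrows_carrier arcs_over_carrier[OF J] by blast
      then show ?case using inverse \<sigma>_inv by simp
    qed (rule \<sigma>_one)
    have \<sigma>X: "fst (\<sigma> (X q)) 0 = \<rho> q" if q: "q \<in> I" for q
    proof -
      have "fst (\<sigma> (X q)) 0 = fst (\<sigma> (inv (\<tau> (target q)))) (0 + h (\<tau> (target q))) \<otimes>\<^bsub>F\<^esub>
          (fst (\<sigma> (arc q)) (start q) \<otimes>\<^bsub>F\<^esub> fst (\<sigma> (\<tau> (start q))) 0)"
        using q \<tau> arc_closed[OF q] by (simp add: X_def \<sigma>_mult G.m_assoc target_def add.commute
            del: \<sigma>.hom_mult \<sigma>.hom_inv)
      also have "\<dots> = \<rho> q"
        using \<sigma>_inv[OF \<tau>(1)[of "target q"], of 0] trivial[OF \<tau>(3)] \<sigma>(4)[OF q] \<rho>_closed[OF q]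
        by (simp del: \<sigma>.hom_inv)
      finally show ?thesis .
    qed
    \<comment> \<open>Evaluation at \<open>0\<close> undoes \<open>\<phi>\<close>. The condition
      \<open>h (\<phi> w) = 0\<close> keeps the base point at \<open>0\<close>, which makes
      evaluation multiplicative.\<close>
    have "subgroup {w \<in> carrier F. fst (\<sigma> (\<phi> w)) 0 = w \<and> h (\<phi> w) = 0} F"
    proof (rule F.subgroupI)
      show "{w \<in> carrier F. fst (\<sigma> (\<phi> w)) 0 = w \<and> h (\<phi> w) = 0} \<noteq> {}"
        using \<sigma>_one by (auto intro!: exI[of _ "\<one>\<^bsub>F\<^esub>"] simp del: \<sigma>.hom_one)
      show "inv\<^bsub>F\<^esub> w \<in> {w \<in> carrier F. fst (\<sigma> (\<phi> w)) 0 = w \<and> h (\<phi> w) = 0}"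
        if "w \<in> {w \<in> carrier F. fst (\<sigma> (\<phi> w)) 0 = w \<and> h (\<phi> w) = 0}" for w
        using that \<sigma>_inv[of "\<phi> w" 0] by (simp del: \<sigma>.hom_inv)
    qed (auto simp: \<sigma>_mult simp del: \<sigma>.hom_mult)
    moreover have "word_class {..<n} {} [(l, True)]
        \<in> {w \<in> carrier F. fst (\<sigma> (\<phi> w)) 0 = w \<and> h (\<phi> w) = 0}" if l: "l \<in> {..<n}" for l
    proof -
      have "e l \<in> I - J" "inv_into {..<n} e (e l) = l"
        using e l by (auto simp: bij_betw_def)
      then show ?thesis
        using \<sigma>X[OF eI[of l]] \<phi>(2)[OF l] X[OF eI[of l]] l
        by (auto simp: \<rho>_def F_def free_group_def intro!: word_class_closed)
    qed
    ultimately have "{w \<in> carrier F. fst (\<sigma> (\<phi> w)) 0 = w \<and> h (\<phi> w) = 0} = carrier F"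
      unfolding F_def free_group_def by (intro presented_group_generated) auto
    then show ?thesis by (intro inj_on_inverseI[of _ "\<lambda>x. fst (\<sigma> x) 0"]) blast
  qed
  ultimately show ?thesis using \<phi>(1) unfolding F_def K_def by blast
qed

end


section \<open>Towers of commuting pairs\<close>

lemma (in group) inv_mult_cancel:
  "x \<in> carrier G \<Longrightarrow> y \<in> carrier G \<Longrightarrow> inv x \<otimes> (x \<otimes> y) = y"
  "x \<in> carrier G \<Longrightarrow> y \<in> carrier G \<Longrightarrow> x \<otimes> (inv x \<otimes> y) = y"
  by (simp_all add: m_assoc[symmetric])

lemma (in group) commute_int_pow:
  assumes "x \<in> carrier G" "y \<in> carrier G" "x \<otimes> y = y \<otimes> x"
  shows "x [^] (k::int) \<otimes> y = y \<otimes> x [^] k"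
proof -
  have "subgroup {g \<in> carrier G. g \<otimes> y = y \<otimes> g} G"
  proof (rule subgroupI)
    show "{g \<in> carrier G. g \<otimes> y = y \<otimes> g} \<noteq> {}" using assms by auto
    show "inv g \<in> {g \<in> carrier G. g \<otimes> y = y \<otimes> g}" if "g \<in> {g \<in> carrier G. g \<otimes> y = y \<otimes> g}" for g
    proof -
      have g: "g \<in> carrier G" "g \<otimes> y = y \<otimes> g" using that by auto
      have "y \<otimes> inv g = inv g \<otimes> (g \<otimes> y) \<otimes> inv g"
        using g(1) assms(2) by (simp add: m_assoc inv_mult_cancel)
      also have "\<dots> = inv g \<otimes> y"
        unfolding g(2) using g(1) assms(2) by (simp add: m_assoc)
      finally have "y \<otimes> inv g = inv g \<otimes> y" .
      then show ?thesis using g by simp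
    qed
    show "g \<otimes> g' \<in> {g \<in> carrier G. g \<otimes> y = y \<otimes> g}"
      if "g \<in> {g \<in> carrier G. g \<otimes> y = y \<otimes> g}" "g' \<in> {g \<in> carrier G. g \<otimes> y = y \<otimes> g}" for g g'
    proof -
      have g: "g \<in> carrier G" "g \<otimes> y = y \<otimes> g" "g' \<in> carrier G" "g' \<otimes> y = y \<otimes> g'"
        using that by auto
      have "g \<otimes> g' \<otimes> y = g \<otimes> y \<otimes> g'" using g(1,3,4) assms(2) by (simp add: m_assoc)
      also have "\<dots> = y \<otimes> (g \<otimes> g')" unfolding g(2) using g assms(2) by (simp add: m_assoc)
      finally show ?thesis using g by simp
    qed
  qed auto
  from subgroup_int_pow_closed[OF this, of x k] assms show ?thesis by blast
qed

section \<open>Translations and loops in a wreath product\<close>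

context group
begin

text \<open>The translation by \<open>a\<close>, conjugated by the function \<open>S\<close>; as a
  functor it is the coboundary of \<open>S\<close>.\<close>

definition shift :: "(int \<Rightarrow> 'a) \<Rightarrow> int \<Rightarrow> (int \<Rightarrow> 'a) \<times> int" where
  "shift S a = (\<lambda>i. S (i + a) \<otimes> inv S i, a)"

text \<open>A loop at every object: the function \<open>d\<close>, conjugated by the same kind of
  \<open>S\<close> so that it can be compared with \<open>shift S a\<close> in one gauge.\<close>

definition loop :: "(int \<Rightarrow> 'a) \<Rightarrow> (int \<Rightarrow> 'a) \<Rightarrow> (int \<Rightarrow> 'a) \<times> int" where
  "loop S d = (\<lambda>i. S i \<otimes> d i \<otimes> inv S i, 0)"

lemma shift_closed [simp]: "(\<And>i. S i \<in> carrier G) \<Longrightarrow> shift S a \<in> carrier (wreath G)"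
  and loop_closed [simp]:
    "(\<And>i. S i \<in> carrier G) \<Longrightarrow> (\<And>i. d i \<in> carrier G) \<Longrightarrow> loop S d \<in> carrier (wreath G)"
  by (simp_all add: wreath_carrier shift_def loop_def)

lemma shift_mult:
  assumes "\<And>i. S i \<in> carrier G"
  shows "shift S (a + c) = shift S a \<otimes>\<^bsub>wreath G\<^esub> shift S c"
  using assms by (simp add: shift_def wreath_mult fun_eq_iff m_assoc inv_mult_cancel algebra_simps)

lemma shift_int_pow:
  assumes "\<And>i. S i \<in> carrier G"
  shows "shift S a [^]\<^bsub>wreath G\<^esub> (k::int) = shift S (k * a)"
proof -
  have "shift S \<in> hom integer_group (wreath G)"
    using assms by (intro homI) (simp_all add: shift_mult)
  then interpret s: group_hom integer_group "wreath G" "shift S"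
    by (simp add: group_hom_def group_hom_axioms_def group_wreath)
  show ?thesis using s.hom_int_pow[of a k] by simp
qed

text \<open>Undoing the conjugation by \<open>S\<close> leaves a translation by \<open>a\<close> and
  an \<open>a\<close>-periodic function.\<close>

lemma shift_loop_commute:
  assumes "\<And>i. S i \<in> carrier G" "\<And>i. d i \<in> carrier G" "\<And>i. d (i + a) = d i"
  shows "shift S a \<otimes>\<^bsub>wreath G\<^esub> loop S d = loop S d \<otimes>\<^bsub>wreath G\<^esub> shift S a"
  using assms by (simp add: shift_def loop_def wreath_mult fun_eq_iff m_assoc inv_mult_cancel)

text \<open>The equation \<open>S (i + m) = fst C i \<otimes> S i\<close> is a recursion along each
  residue class modulo \<open>m\<close>; as \<open>m \<noteq> 0\<close>, it can be solved with any
  given values on \<open>{0..<\<bar>m\<bar>}\<close>. This is the freeness of the groupoid of an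
  edge group, whose components are lines.\<close>

lemma shift_extension:
  assumes C: "C \<in> carrier (wreath G)" "snd C = m" "m \<noteq> 0" and S0: "\<And>i. S0 i \<in> carrier G"
  shows "\<exists>S. (\<forall>i. S i \<in> carrier G) \<and> shift S m = C \<and> (\<forall>i\<in>{0..<\<bar>m\<bar>}. S i = S0 i)"
proof -
  interpret W: group "wreath G" by (rule group_wreath)
  \<comment> \<open>The signed number of steps of length \<open>m\<close> from the residue of
    \<open>i\<close> to \<open>i\<close>, for either sign of \<open>m\<close>.\<close>
  define q where "q i = (i - i mod \<bar>m\<bar>) div m" for i
  have q: "q i * m = i - i mod \<bar>m\<bar>" for i
    unfolding q_def by (rule dvd_div_mult_self) (metis abs_dvd_iff dvd_minus_mod)
  have q_add: "q (i + m) = q i + 1" for i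
  proof -
    have "q (i + m) * m = (q i + 1) * m"
      using q[of i] q[of "i + m"] by (simp add: algebra_simps mod_add_right_eq[of i m "\<bar>m\<bar>", symmetric])
    then show ?thesis using C(3) by simp
  qed
  define S where "S i = fst (C [^]\<^bsub>wreath G\<^esub> q i) (i mod \<bar>m\<bar>) \<otimes> S0 (i mod \<bar>m\<bar>)" for i
  have pow_closed: "fst (C [^]\<^bsub>wreath G\<^esub> (k::int)) i \<in> carrier G" for k i
    using W.int_pow_closed[OF C(1), of k] by (simp add: wreath_carrier)
  have C_closed: "fst C i \<in> carrier G" for i using C(1) by (simp add: wreath_carrier)
  have S: "S i \<in> carrier G" for i using S0 pow_closed by (simp add: S_def)
  have S_add: "S (i + m) = fst C i \<otimes> S i" for i
  proof -
    have "C [^]\<^bsub>wreath G\<^esub> (1 + q i) = C \<otimes>\<^bsub>wreath G\<^esub> C [^]\<^bsub>wreath G\<^esub> q i"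
      using W.int_pow_mult[OF C(1), of 1 "q i"] W.int_pow_1[OF C(1)] by simp
    then have "fst (C [^]\<^bsub>wreath G\<^esub> (q i + 1)) (i mod \<bar>m\<bar>)
        = fst C (i mod \<bar>m\<bar> + q i * m) \<otimes> fst (C [^]\<^bsub>wreath G\<^esub> q i) (i mod \<bar>m\<bar>)"
      by (simp add: wreath_mult wreath_snd_int_pow[OF C(1)] C(2) add.commute)
    moreover have "(i + m) mod \<bar>m\<bar> = i mod \<bar>m\<bar>"
      by (simp add: mod_add_right_eq[of i m "\<bar>m\<bar>", symmetric])
    ultimately show ?thesis
      using C_closed pow_closed S0 by (simp add: S_def q_add q m_assoc)
  qed
  have "shift S m = C"
    using S C_closed C(2) by (cases C) (simp add: shift_def S_add m_assoc fun_eq_iff)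
  moreover have "S i = S0 i" if "i \<in> {0..<\<bar>m\<bar>}" for i
    using that S0 by (simp add: S_def q_def wreath_one)
  ultimately show ?thesis using S by blast
qed

end

text \<open>
  The last two assumptions say that \<open>G\<close> is presented by the \<open>t j\<close>, \<open>b j\<close> and the relations above
  them; homomorphisms into groups of the form \<open>wreath L\<close> with \<open>L\<close> free are the only ones needed.
  The convention \<open>k 0 = 1\<close> makes the root behave like the other indices.
\<close>

locale tower = group G for G :: "('a, 'm) monoid_scheme" (structure) +
  fixes N :: nat and t b :: "nat \<Rightarrow> 'a" and u :: "nat \<Rightarrow> nat" and x y k :: "nat \<Rightarrow> int"
  assumes t_closed: "j \<le> N \<Longrightarrow> t j \<in> carrier G"
    and b_closed: "j \<le> N \<Longrightarrow> b j \<in> carrier G"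
    and commute: "j \<le> N \<Longrightarrow> t j \<otimes> b j = b j \<otimes> t j"
    and parent_less: "0 < j \<Longrightarrow> j \<le> N \<Longrightarrow> u j < j"
    and x_nonzero: "0 < j \<Longrightarrow> j \<le> N \<Longrightarrow> x j \<noteq> 0"
    and k_nonzero: "j \<le> N \<Longrightarrow> k j \<noteq> 0"
    and k_root: "k 0 = 1"
    and relation: "0 < j \<Longrightarrow> j \<le> N \<Longrightarrow> t (u j) [^] x j \<otimes> b (u j) [^] y j = t j [^] k j"
    and generated: "subgroup H G \<Longrightarrow> (\<And>j. j \<le> N \<Longrightarrow> t j \<in> H \<and> b j \<in> H) \<Longrightarrow> H = carrier G"
    and universal: "\<And>(L :: ((int \<Rightarrow> nat word set) \<times> int) monoid) t' b'. group L \<Longrightarrow>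
      (\<And>j. j \<le> N \<Longrightarrow> t' j \<in> carrier L \<and> b' j \<in> carrier L \<and> t' j \<otimes>\<^bsub>L\<^esub> b' j = b' j \<otimes>\<^bsub>L\<^esub> t' j) \<Longrightarrow>
      (\<And>j. 0 < j \<Longrightarrow> j \<le> N \<Longrightarrow>
        t' (u j) [^]\<^bsub>L\<^esub> x j \<otimes>\<^bsub>L\<^esub> b' (u j) [^]\<^bsub>L\<^esub> y j = t' j [^]\<^bsub>L\<^esub> k j) \<Longrightarrow>
      \<exists>\<sigma>\<in>hom G L. \<forall>j\<le>N. \<sigma> (t j) = t' j \<and> \<sigma> (b j) = b' j"
begin

text \<open>The equation is the image of the tower relation under a homomorphism to \<int> with
  values \<open>n j\<close> on \<open>t j\<close> and \<open>0\<close> on \<open>b j\<close>;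
  \<open>n j \<noteq> 0\<close> keeps nontrivial powers of \<open>t j\<close> from being
  killed.\<close>

definition heights :: "(nat \<Rightarrow> int) \<Rightarrow> bool" where
  "heights n \<longleftrightarrow> (\<forall>j\<le>N. n j \<noteq> 0) \<and> (\<forall>j. 0 < j \<longrightarrow> j \<le> N \<longrightarrow> k j * n j = x j * n (u j))"

lemma heights_exist: "\<exists>n. heights n"
proof -
  have "\<exists>n. (\<forall>j\<le>M. n j \<noteq> 0) \<and> (\<forall>j. 0 < j \<longrightarrow> j \<le> M \<longrightarrow> k j * n j = x j * n (u j))"
    if "M \<le> N" for M
    using that
  proof (induction M)
    case 0
    then show ?case by (intro exI[of _ "\<lambda>_. 1"]) simp
  next
    case (Suc M)
    then obtain n where n: "\<And>j. j \<le> M \<Longrightarrow> n j \<noteq> 0"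
      "\<And>j. 0 < j \<Longrightarrow> j \<le> M \<Longrightarrow> k j * n j = x j * n (u j)" by auto
    \<comment> \<open>Multiplying all earlier heights by \<open>k (Suc M)\<close> makes the new
      equation solvable over \<int> and preserves the old ones, which are homogeneous.\<close>
    define n' where "n' j = (if j = Suc M then x j * n (u j) else k (Suc M) * n j)" for j
    have u: "u j \<le> M" if "0 < j" "j \<le> Suc M" for j
      using parent_less[of j] that Suc.prems by auto
    have "n' j \<noteq> 0" if "j \<le> Suc M" for j
      using that n(1) u[of j] x_nonzero[of j] k_nonzero[of "Suc M"] Suc.prems
      by (auto simp: n'_def le_Suc_eq)
    moreover have "k j * n' j = x j * n' (u j)" if "0 < j" "j \<le> Suc M" for j
      using that n(2)[of j] u[OF that] by (auto simp: n'_def le_Suc_eq algebra_simps)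
    ultimately show ?case by blast
  qed
  from this[of N] show ?thesis by (auto simp: heights_def)
qed

text \<open>\<open>universal\<close> only offers targets of the type of a wreath product, so \<int>
  is found as the translations in the wreath product over the trivial group
  \<open>free_group {}\<close>.\<close>

lemma heights_hom:
  assumes "heights n"
  shows "\<exists>h\<in>hom G integer_group. \<forall>j\<le>N. h (t j) = n j \<and> h (b j) = 0"
proof -
  define F where "F = (free_group {} :: nat word set monoid)"
  interpret F: group F unfolding F_def by (rule group_free_group)
  let ?c = "F.shift (\<lambda>_. \<one>\<^bsub>F\<^esub>)"
  interpret W: group "wreath F" by (rule F.group_wreath)
  have "\<exists>\<sigma>\<in>hom G (wreath F). \<forall>j\<le>N. \<sigma> (t j) = ?c (n j) \<and> \<sigma> (b j) = ?c 0"
    using assms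
    by (intro universal F.group_wreath)
      (auto simp: F.shift_int_pow F.shift_mult[symmetric] heights_def add.commute mult.commute)
  then obtain \<sigma> where \<sigma>: "\<sigma> \<in> hom G (wreath F)" "\<And>j. j \<le> N \<Longrightarrow> \<sigma> (t j) = ?c (n j) \<and> \<sigma> (b j) = ?c 0"
    by blast
  have "snd \<circ> \<sigma> \<in> hom G integer_group"
    using \<sigma>(1) by (auto simp: hom_def wreath_mult)
  then show ?thesis using \<sigma>(2) by (intro bexI[of _ "snd \<circ> \<sigma>"]) (auto simp: F.shift_def)
qed

text \<open>
  If the image of \<open>h\<close> is \<open>d\<int>\<close>, the heights can be divided by \<open>d\<close>; so heights with the smallest
  possible value at the root give a surjective \<open>h\<close>.
\<close>

lemma surjective_heights:
  "\<exists>n h. heights n \<and> h \<in> hom G integer_group \<and> (\<forall>j\<le>N. h (t j) = n j \<and> h (b j) = 0) \<and>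
    (\<exists>z\<in>carrier G. h z = 1)"
proof -
  obtain n where n: "heights n" and least: "\<And>n'. heights n' \<Longrightarrow> nat \<bar>n 0\<bar> \<le> nat \<bar>n' 0\<bar>"
    using heights_exist ex_has_least_nat[of heights _ "\<lambda>n. nat \<bar>n 0\<bar>"] by blast
  obtain h where h: "h \<in> hom G integer_group" "\<And>j. j \<le> N \<Longrightarrow> h (t j) = n j \<and> h (b j) = 0"
    using heights_hom[OF n] by blast
  interpret h: group_hom G integer_group h
    by (simp add: group_hom_def group_hom_axioms_def h is_group)
  have n0: "n 0 \<noteq> 0" using n by (simp add: heights_def)
  have t0: "t 0 \<in> carrier G" "h (t 0) = n 0" using t_closed h(2) by auto
  have "\<exists>z\<in>carrier G. 0 < h z"
  proof (cases "n 0 > 0")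
    case True
    then show ?thesis using t0 by (intro bexI[of _ "t 0"]) auto
  next
    case False
    then show ?thesis using t0 n0 by (intro bexI[of _ "inv (t 0)"]) auto
  qed
  then obtain z0 where "z0 \<in> carrier G \<and> 0 < h z0" by blast
  from ex_has_least_nat[of "\<lambda>z. z \<in> carrier G \<and> 0 < h z", OF this, of "\<lambda>z. nat (h z)"]
  obtain z where z: "z \<in> carrier G" "0 < h z"
    and min: "\<And>g. g \<in> carrier G \<Longrightarrow> 0 < h g \<Longrightarrow> h z \<le> h g" by force
  \<comment> \<open>The least positive value of \<open>h\<close> divides all values, by division
    with remainder.\<close>
  have dvd: "h z dvd h g" if g: "g \<in> carrier G" for g
  proof (rule ccontr)
    assume "\<not> h z dvd h g"
    then have "0 < h g mod h z" "h g mod h z < h z"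
      using z(2) by (simp_all add: dvd_eq_mod_eq_0 order_less_le[of 0])
    moreover define g' where "g' = g \<otimes> z [^] (- (h g div h z))"
    have "h g' = h g mod h z"
      using g z h.hom_int_pow[OF z(1)] by (simp add: g'_def minus_div_mult_eq_mod[symmetric])
    moreover have "g' \<in> carrier G" using g z by (simp add: g'_def)
    ultimately show False using min[of g'] by simp
  qed
  have div: "n j div h z * h z = n j" if "j \<le> N" for j
    using dvd[OF t_closed[OF that]] h(2)[OF that] by simp
  have "heights (\<lambda>j. n j div h z)"
    unfolding heights_def
  proof (intro conjI allI impI)
    show "n j div h z \<noteq> 0" if "j \<le> N" for j
      using div[OF that] n that by (auto simp: heights_def)
    show "k j * (n j div h z) = x j * (n (u j) div h z)" if "0 < j" "j \<le> N" for j
    proof -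
      have "k j * (n j div h z) * h z = x j * (n (u j) div h z) * h z"
        using n that div[of j] div[of "u j"] parent_less[OF that]
        by (simp add: heights_def mult.assoc)
      then show ?thesis using z(2) by simp
    qed
  qed
  \<comment> \<open>Dividing by some \<open>h z > 1\<close> would have lowered the absolute height
    of the root.\<close>
  from least[OF this] have "\<bar>n 0\<bar> \<le> \<bar>n 0 div h z\<bar>" by simp
  moreover have "\<bar>n 0\<bar> = \<bar>n 0 div h z\<bar> * h z"
    using div[of 0] z(2) by (metis abs_mult abs_of_pos le0)
  moreover have "\<bar>n 0 div h z\<bar> > 0" using div[of 0] n0 by auto
  ultimately have "h z \<le> 1" 
    by (metis mult_le_cancel_left1 not_less order.trans mult.right_neutral mult_le_cancel_left_pos)
  then have "h z = 1" using z(2) by simp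
  then show ?thesis using n h z(1) by blast
qed

end

section \<open>The action groupoid of a tower with fixed heights\<close>

locale tower_heights = tower +
  fixes n :: "nat \<Rightarrow> int" and h :: "'a \<Rightarrow> int"
  assumes heights: "heights n"
    and h_hom: "h \<in> hom G integer_group"
    and h_t: "j \<le> N \<Longrightarrow> h (t j) = n j"
    and h_b: "j \<le> N \<Longrightarrow> h (b j) = 0"
    and h_surj: "\<exists>z\<in>carrier G. h z = 1"
begin

lemma n_nonzero: "j \<le> N \<Longrightarrow> n j \<noteq> 0"
  and n_relation: "0 < j \<Longrightarrow> j \<le> N \<Longrightarrow> k j * n j = x j * n (u j)"
  using heights by (auto simp: heights_def)

sublocale h: group_hom G integer_group h
  by (simp add: group_hom_def group_hom_axioms_def h_hom is_group)

lemma h_t_pow: "j \<le> N \<Longrightarrow> h (t j [^] (e::int)) = e * n j"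
  using h.hom_int_pow[OF t_closed] h_t by simp

text \<open>
  Given the arrows of the root or of the parent edge, which join \<open>i\<close> to \<open>i + k j * n j\<close>, the groupoid
  of the \<open>j\<close>-th pair becomes free on the following arrows: powers of \<open>t j\<close> from the residue of \<open>i\<close>
  modulo \<open>\<bar>n j\<bar>\<close> to \<open>i\<close>, and one loop \<open>b j\<close> at each residue.
\<close>

definition index :: "(nat \<times> bool \<times> int) set" where
  "index = (\<Union>j\<le>N. {j} \<times> ({True} \<times> {\<bar>n j\<bar>..<\<bar>k j * n j\<bar>} \<union> {False} \<times> {0..<\<bar>n j\<bar>}))"

text \<open>The signed number of \<open>t j\<close>-steps, each of length \<open>n j\<close>, from
  the residue of \<open>i\<close> modulo \<open>\<bar>n j\<bar>\<close> to \<open>i\<close>. It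
  vanishes for \<open>0 \<le> i < \<bar>n j\<bar>\<close>, which is why the indices with
  \<open>True\<close> begin at \<open>\<bar>n j\<bar>\<close>; at the root, where
  \<open>k 0 = 1\<close>, there are none of them.\<close>

definition level :: "nat \<Rightarrow> int \<Rightarrow> int" where
  "level j i = (i - i mod \<bar>n j\<bar>) div n j"

definition arc :: "nat \<times> bool \<times> int \<Rightarrow> 'a" where
  "arc = (\<lambda>(j, c, i). if c then t j [^] level j i else b j)"

definition start :: "nat \<times> bool \<times> int \<Rightarrow> int" where
  "start = (\<lambda>(j, c, i). if c then i mod \<bar>n j\<bar> else i)"

lemma level: "level j i * n j = i - i mod \<bar>n j\<bar>"
  unfolding level_def by (rule dvd_div_mult_self) (metis abs_dvd_iff dvd_minus_mod)

lemma abs_mod_add: "(i + m) mod \<bar>m\<bar> = i mod \<bar>m :: int\<bar>"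
  by (simp add: mod_add_right_eq[of i m "\<bar>m\<bar>", symmetric])

abbreviation all_arrows :: "('a \<times> int) set" where
  "all_arrows \<equiv> arrows G h ((\<lambda>q. (arc q, start q)) ` index \<union> {t 0} \<times> UNIV)"

text \<open>The powers of \<open>t j [^] k j\<close> and the arrows indexed with \<open>True\<close>
  join each residue modulo \<open>\<bar>n j\<bar>\<close> to all integers of its class. An arrow of
  \<open>t j\<close> then runs back to the residue and out again; one of \<open>b j\<close> is
  carried to the residue, where a loop is given, because \<open>b j\<close> commutes with
  \<open>t j\<close>.\<close>

lemma full_step:
  assumes j: "j \<le> N" and full: "\<And>i. (t j [^] k j, i) \<in> all_arrows"
  shows "(t j, i) \<in> all_arrows" "(b j, i) \<in> all_arrows"
proof -
  have nj: "n j \<noteq> 0" by (rule n_nonzero[OF j])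
  have tj: "t j \<in> carrier G" by (rule t_closed[OF j])
  have tk: "t j [^] k j \<in> {g \<in> carrier G. \<forall>i. (g, i) \<in> all_arrows}" using full tj by simp
  have full_pow: "((t j [^] k j) [^] (e::int), i) \<in> all_arrows" for e i
    using subgroup_int_pow_closed[OF subgroup_full_arrows[OF h.group_hom_axioms] tk, of e] by blast
  have near: "(t j [^] level j i, i mod \<bar>n j\<bar>) \<in> all_arrows" if i: "0 \<le> i" "i < \<bar>k j * n j\<bar>" for i
  proof (cases "i < \<bar>n j\<bar>")
    case True
    then have "level j i = 0" using i(1) by (simp add: level_def)
    then show ?thesis by (simp add: arrows.unit)
  next
    case False
    then have "(j, True, i) \<in> index" using j i by (auto simp: index_def)
    then have "(arc (j, True, i), start (j, True, i)) \<in> all_arrows"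
      by (intro arrows.arc) blast
    then show ?thesis by (simp add: arc_def start_def)
  qed
  \<comment> \<open>Reducing \<open>i\<close> modulo \<open>\<bar>k j * n j\<bar>\<close> leads into
    the range of \<open>near\<close>; a power of \<open>t j [^] k j\<close> covers the
    difference.\<close>
  have ray: "(t j [^] level j i, i mod \<bar>n j\<bar>) \<in> all_arrows" for i
  proof -
    define m where "m = k j * n j"
    have m: "m \<noteq> 0" using nj k_nonzero[OF j] by (simp add: m_def)
    define r where "r = i mod \<bar>m\<bar>"
    define e where "e = (i - r) div m"
    have e: "e * m = i - r"
      unfolding e_def r_def by (rule dvd_div_mult_self) (metis abs_dvd_iff dvd_minus_mod)
    have r: "0 \<le> r" "r < \<bar>m\<bar>" using m by (auto simp: r_def)
    have rm: "r mod \<bar>n j\<bar> = i mod \<bar>n j\<bar>"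
      unfolding r_def by (rule mod_mod_cancel) (simp add: m_def abs_mult)
    have "(t j [^] level j r, r mod \<bar>n j\<bar>) \<in> all_arrows"
      using near r by (simp add: m_def)
    from arrows.comp[OF this full_pow]
    have "((t j [^] k j) [^] e \<otimes> t j [^] level j r, i mod \<bar>n j\<bar>) \<in> all_arrows"
      by (simp add: rm)
    moreover have "(t j [^] k j) [^] e \<otimes> t j [^] level j r = t j [^] (k j * e + level j r)"
      using tj by (simp add: int_pow_pow int_pow_mult)
    moreover have "k j * e + level j r = level j i"
    proof -
      have "(k j * e + level j r) * n j = e * m + level j r * n j"
        by (simp add: m_def algebra_simps)
      also have "\<dots> = level j i * n j" using e by (simp add: level rm)
      finally have "(k j * e + level j r) * n j = level j i * n j" .
      then show ?thesis using nj by simp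
    qed
    ultimately show ?thesis by simp
  qed
  have return: "(inv (t j [^] level j i), i) \<in> all_arrows" for i
    using arrows.inverse[OF ray[of i]] by (simp add: h_t_pow[OF j] level)
  have level_add: "level j (i + n j) = level j i + 1"
  proof -
    have "level j (i + n j) * n j = (level j i + 1) * n j"
      using level[of j i] level[of j "i + n j"] by (simp add: algebra_simps abs_mod_add)
    then show ?thesis using nj by simp
  qed
  have h_back: "i + h (inv (t j [^] level j i)) = i mod \<bar>n j\<bar>"
    using tj by (simp add: h_t_pow[OF j] level)
  have "(t j [^] (1 + level j i), i mod \<bar>n j\<bar>) \<in> all_arrows"
    using ray[of "i + n j"] by (simp add: level_add abs_mod_add add.commute)
  from arrows.comp[OF return[of i] this[folded h_back]]
  show "(t j, i) \<in> all_arrows" using tj by (simp add: int_pow_mult m_assoc)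
  have "(j, False, i mod \<bar>n j\<bar>) \<in> index" using j nj by (auto simp: index_def)
  then have "(arc (j, False, i mod \<bar>n j\<bar>), start (j, False, i mod \<bar>n j\<bar>)) \<in> all_arrows"
    by (intro arrows.arc) blast
  then have "(b j, i mod \<bar>n j\<bar>) \<in> all_arrows" by (simp add: arc_def start_def)
  from arrows.comp[OF return[of i] this[folded h_back]]
  have "(b j \<otimes> inv (t j [^] level j i), i) \<in> all_arrows" .
  from arrows.comp[OF this, of "t j [^] level j i"]
  have "(t j [^] level j i \<otimes> (b j \<otimes> inv (t j [^] level j i)), i) \<in> all_arrows"
    using ray[of i] tj b_closed[OF j] by (simp add: h_b[OF j] h_t_pow[OF j] level)
  moreover have "t j [^] level j i \<otimes> (b j \<otimes> inv (t j [^] level j i)) = b j"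
    using commute_int_pow[OF tj b_closed[OF j] commute[OF j], of "level j i"] tj b_closed[OF j]
    by (simp add: m_assoc[symmetric]) (simp add: m_assoc)
  ultimately show "(b j, i) \<in> all_arrows" by simp
qed

text \<open>Induction along the tower: the relation expresses \<open>t j [^] k j\<close> through the
  parent, and at the root \<open>k 0 = 1\<close> makes it \<open>t 0\<close>, whose arrows are all
  given.\<close>

lemma all_arrows_full:
  assumes g: "g \<in> carrier G"
  shows "(g, i) \<in> all_arrows"
proof -
  define W where "W = {g \<in> carrier G. \<forall>i. (g, i) \<in> all_arrows}"
  have W: "subgroup W G" unfolding W_def by (rule subgroup_full_arrows[OF h.group_hom_axioms])
  have "t j \<in> W \<and> b j \<in> W" if "j \<le> N" for j
    using that
  proof (induction j rule: less_induct)
    case (less j)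
    have "t j [^] k j \<in> W"
    proof (cases "j = 0")
      case True
      then show ?thesis using t_closed[of 0] by (simp add: k_root W_def arrows.arc)
    next
      case False
      then have "t (u j) \<in> W \<and> b (u j) \<in> W"
        using less parent_less[of j] by simp
      then have "t (u j) [^] x j \<otimes> b (u j) [^] y j \<in> W"
        by (intro subgroup.m_closed[OF W] subgroup_int_pow_closed[OF W]) simp_all
      then show ?thesis using relation[of j] False less.prems by simp
    qed
    then have "(t j [^] k j, i) \<in> all_arrows" for i by (simp add: W_def)
    from full_step[OF less.prems this] show ?case
      using t_closed[OF less.prems] b_closed[OF less.prems] by (simp add: W_def)
  qed
  from generated[OF W this] show ?thesis using g unfolding W_def by blast
qed

text \<open>Each \<open>t j\<close> is sent to a coboundary \<open>shift (S j) (n j)\<close> and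
  each \<open>b j\<close> to a loop in the same gauge, so that the two commute. The relation with
  the parent prescribes \<open>shift (S j) (k j * n j)\<close>, which leaves the values of
  \<open>S j\<close> on \<open>{0..<\<bar>k j * n j\<bar>}\<close> free; those from
  \<open>\<bar>n j\<bar>\<close> on carry the data \<open>\<rho>\<close> of the \<open>True\<close>
  arrows.\<close>

lemma cocycles_free:
  fixes L :: "nat word set monoid"
  assumes L: "group L" and \<rho>: "\<And>q. q \<in> index \<Longrightarrow> \<rho> q \<in> carrier L"
  shows "\<exists>\<sigma>\<in>hom G (wreath L). (\<forall>g\<in>carrier G. snd (\<sigma> g) = h g) \<and>
    (\<forall>i. fst (\<sigma> (t 0)) i = \<one>\<^bsub>L\<^esub>) \<and> (\<forall>q\<in>index. fst (\<sigma> (arc q)) (start q) = \<rho> q)"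
proof -
  interpret L: group L by (rule L)
  interpret W: group "wreath L" by (rule L.group_wreath)
  \<comment> \<open>Reduction modulo \<open>\<bar>n j\<bar>\<close> makes \<open>d j\<close>
    periodic, so that its loop commutes with \<open>T S j\<close>.\<close>
  define d where "d j i = (if j \<le> N then \<rho> (j, False, i mod \<bar>n j\<bar>) else \<one>\<^bsub>L\<^esub>)" for j i
  have d: "d j i \<in> carrier L" for j i
    using \<rho>[of "(j, False, i mod \<bar>n j\<bar>)"] n_nonzero[of j] by (auto simp: d_def index_def)
  define B where "B S j = L.loop (S j) (d j)" for S j
  define T where "T S j = L.shift (S j) (n j)" for S j
  \<comment> \<open>The value forced on \<open>t j [^] k j\<close>. At the root it is the pure
    translation, so that the arrows of \<open>t 0\<close> become trivial.\<close>
  define C where "C S j = (if j = 0 then L.shift (\<lambda>_. \<one>\<^bsub>L\<^esub>) (n 0)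
    else T S (u j) [^]\<^bsub>wreath L\<^esub> x j \<otimes>\<^bsub>wreath L\<^esub> B S (u j) [^]\<^bsub>wreath L\<^esub> y j)" for S j
  \<comment> \<open>\<open>S j\<close> is one on the residues modulo \<open>\<bar>n j\<bar>\<close>,
    so the arrow from a residue to \<open>i\<close> gets the value \<open>S j i\<close>, which is to
    be the prescribed one.\<close>
  define good where "good S j \<longleftrightarrow> (\<forall>i. S j i \<in> carrier L) \<and> L.shift (S j) (k j * n j) = C S j \<and>
    (\<forall>i\<in>{0..<\<bar>k j * n j\<bar>}. S j i = (if i < \<bar>n j\<bar> then \<one>\<^bsub>L\<^esub> else \<rho> (j, True, i)))" for S j
  have "\<exists>S. \<forall>j<M. good S j" if "M \<le> Suc N" for M
    using that
  proof (induction M)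
    case (Suc M)
    then obtain S where S: "\<And>j. j < M \<Longrightarrow> good S j" by auto
    have M: "M \<le> N" using Suc.prems by simp
    have u: "u j < M" if "0 < j" "j \<le> M" for j using parent_less[of j] that M by simp
    have CM: "C S M \<in> carrier (wreath L) \<and> snd (C S M) = k M * n M"
    proof (cases "M = 0")
      case True
      then show ?thesis by (simp add: C_def k_root) (simp add: L.shift_def)
    next
      case False
      then have "S (u M) i \<in> carrier L" for i using S[OF u[of M]] by (simp add: good_def)
      then have TB: "T S (u M) \<in> carrier (wreath L)" "B S (u M) \<in> carrier (wreath L)"
        using d by (simp_all add: T_def B_def)
      then have "snd (C S M) = x M * n (u M)"
        using False by (simp add: C_def wreath_mult L.wreath_snd_int_pow)
          (simp add: T_def B_def L.shift_def L.loop_def)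
      then show ?thesis using TB False n_relation[of M] M by (simp add: C_def)
    qed
    define S0 where "S0 i = (if i \<in> {\<bar>n M\<bar>..<\<bar>k M * n M\<bar>} then \<rho> (M, True, i) else \<one>\<^bsub>L\<^esub>)" for i
    have S0: "S0 i \<in> carrier L" for i
      using \<rho>[of "(M, True, i)"] M by (auto simp: S0_def index_def)
    have "\<exists>R. (\<forall>i. R i \<in> carrier L) \<and> L.shift R (k M * n M) = C S M \<and>
        (\<forall>i\<in>{0..<\<bar>k M * n M\<bar>}. R i = S0 i)"
      using CM k_nonzero[OF M] n_nonzero[OF M] S0 by (intro L.shift_extension) auto
    then obtain R where R: "\<And>i. R i \<in> carrier L" "L.shift R (k M * n M) = C S M"
      "\<And>i. i \<in> {0..<\<bar>k M * n M\<bar>} \<Longrightarrow> R i = S0 i"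
      by blast
    define S' where "S' = S(M := R)"
    \<comment> \<open>\<open>C S j\<close> looks at \<open>S\<close> only in \<open>u j < j\<close>,
      so changing \<open>S\<close> at \<open>M\<close> leaves it intact for all indices up to
      \<open>M\<close>.\<close>
    have C': "C S' j = C S j" if "j \<le> M" for j
      using u[of j] that by (cases "j = 0") (simp_all add: C_def T_def B_def S'_def)
    have "good S' M"
      using R C'[of M] by (auto simp: good_def S'_def S0_def)
    moreover have "good S' j" if "j < M" for j
      using S[OF that] C'[of j] that by (simp add: good_def S'_def)
    ultimately show ?case by (auto simp: less_Suc_eq)
  qed simp
  from this[of "Suc N"] obtain S where good: "\<And>j. j \<le> N \<Longrightarrow> good S j" by (auto simp: less_Suc_eq_le)
  have S: "S j i \<in> carrier L" if "j \<le> N" for j i using good[OF that] by (simp add: good_def)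
  have TC: "T S j [^]\<^bsub>wreath L\<^esub> k j = C S j" if "j \<le> N" for j
    using good[OF that] S[OF that] by (simp add: T_def L.shift_int_pow good_def)
  have TB: "T S j \<in> carrier (wreath L)" "B S j \<in> carrier (wreath L)" if "j \<le> N" for j
    using S[OF that] d by (simp_all add: T_def B_def)
  have "\<exists>\<sigma>\<in>hom G (wreath L). \<forall>j\<le>N. \<sigma> (t j) = T S j \<and> \<sigma> (b j) = B S j"
  proof (rule universal[OF L.group_wreath])
    fix j assume j: "j \<le> N"
    have "d j (i + n j) = d j i" for i by (simp add: d_def abs_mod_add)
    then have "T S j \<otimes>\<^bsub>wreath L\<^esub> B S j = B S j \<otimes>\<^bsub>wreath L\<^esub> T S j"
      using S[OF j] d unfolding T_def B_def by (intro L.shift_loop_commute)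
    then show "T S j \<in> carrier (wreath L) \<and> B S j \<in> carrier (wreath L) \<and>
        T S j \<otimes>\<^bsub>wreath L\<^esub> B S j = B S j \<otimes>\<^bsub>wreath L\<^esub> T S j"
      using TB[OF j] by simp
  next
    fix j assume "0 < j" "j \<le> N"
    then show "T S (u j) [^]\<^bsub>wreath L\<^esub> x j \<otimes>\<^bsub>wreath L\<^esub> B S (u j) [^]\<^bsub>wreath L\<^esub> y j
        = T S j [^]\<^bsub>wreath L\<^esub> k j"
      using TC[of j] by (simp add: C_def)
  qed
  then obtain \<sigma> where \<sigma>: "\<sigma> \<in> hom G (wreath L)" "\<And>j. j \<le> N \<Longrightarrow> \<sigma> (t j) = T S j"
    "\<And>j. j \<le> N \<Longrightarrow> \<sigma> (b j) = B S j" by blast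
  interpret \<sigma>: group_hom G "wreath L" \<sigma>
    by (simp add: group_hom_def group_hom_axioms_def \<sigma> is_group L.group_wreath)
  have \<sigma>_pow: "\<sigma> (t j [^] (e::int)) = L.shift (S j) (e * n j)" if "j \<le> N" for j e
    using \<sigma>.hom_int_pow[OF t_closed[OF that]] \<sigma>(2)[OF that] S[OF that]
    by (simp add: T_def L.shift_int_pow)
  have s\<sigma>: "group_hom G integer_group (\<lambda>g. snd (\<sigma> g))"
    using \<sigma>(1) by (auto simp: group_hom_def group_hom_axioms_def is_group hom_def wreath_mult)
  interpret s\<sigma>: group_hom G integer_group "\<lambda>g. snd (\<sigma> g)" by (rule s\<sigma>)
  \<comment> \<open>\<open>\<sigma>\<close> lies over \<open>h\<close> because the two agree on the
    generators.\<close>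
  have "subgroup {g \<in> carrier G. snd (\<sigma> g) = h g} G"
    by (rule subgroupI)
      (use s\<sigma>.hom_mult s\<sigma>.hom_inv s\<sigma>.hom_one in \<open>auto simp del: \<sigma>.hom_mult \<sigma>.hom_inv \<sigma>.hom_one
        intro!: exI[of _ \<one>]\<close>)
  moreover have "t j \<in> {g \<in> carrier G. snd (\<sigma> g) = h g} \<and> b j \<in> {g \<in> carrier G. snd (\<sigma> g) = h g}"
    if "j \<le> N" for j
    using that t_closed b_closed h_t h_b
    by (simp add: \<sigma> T_def B_def L.shift_def L.loop_def)
  ultimately have "{g \<in> carrier G. snd (\<sigma> g) = h g} = carrier G" by (rule generated)
  then have "\<forall>g\<in>carrier G. snd (\<sigma> g) = h g" by blast
  moreover have "fst (\<sigma> (t 0)) i = \<one>\<^bsub>L\<^esub>" for i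
  proof -
    have "\<sigma> (t 0) = C S 0"
      using TC[of 0] TB[of 0] \<sigma>(2)[of 0] by (simp add: k_root W.int_pow_1)
    then show ?thesis by (simp add: C_def L.shift_def)
  qed
  moreover have "fst (\<sigma> (arc q)) (start q) = \<rho> q" if q: "q \<in> index" for q
  proof -
    obtain j c i where qe: "q = (j, c, i)" by (cases q)
    have j: "j \<le> N" using q by (auto simp: index_def qe)
    have small: "S j i' = \<one>\<^bsub>L\<^esub>" if i': "0 \<le> i'" "i' < \<bar>n j\<bar>" for i'
    proof -
      have "\<bar>n j\<bar> * 1 \<le> \<bar>n j\<bar> * \<bar>k j\<bar>"
        using k_nonzero[OF j] by (intro mult_left_mono) auto
      then have "i' < \<bar>k j * n j\<bar>" using i'(2) by (simp add: abs_mult mult.commute)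
      then show ?thesis using good[OF j] i' by (simp add: good_def)
    qed
    show ?thesis
    proof (cases c)
      case True
      then have i: "\<bar>n j\<bar> \<le> i" "i < \<bar>k j * n j\<bar>" using q by (auto simp: index_def qe)
      have "S j i = \<rho> q" using good[OF j] i True by (simp add: good_def qe)
      moreover have "S j (i mod \<bar>n j\<bar>) = \<one>\<^bsub>L\<^esub>" using n_nonzero[OF j] by (intro small) auto
      ultimately show ?thesis
        using True \<rho>[OF q]
        by (simp add: qe arc_def start_def \<sigma>_pow[OF j] L.shift_def level)
    next
      case False
      then have i: "0 \<le> i" "i < \<bar>n j\<bar>" using q by (auto simp: index_def qe)
      then show ?thesis
        using False \<rho>[OF q] small[OF i] j
        by (simp add: qe arc_def start_def \<sigma>(3)[OF j] B_def L.loop_def d_def)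
    qed
  qed
  ultimately show ?thesis using \<sigma>(1) by blast
qed

lemma free_action_groupoid: "free_action_groupoid G h (t 0) index arc start"
proof (intro free_action_groupoid.intro free_action_groupoid_axioms.intro)
  show "group_hom G integer_group h" by (rule h.group_hom_axioms)
  show "finite index" by (simp add: index_def)
  show "t 0 \<in> carrier G" "h (t 0) \<noteq> 0" using t_closed[of 0] h_t[of 0] n_nonzero[of 0] by auto
  show "arc q \<in> carrier G" if "q \<in> index" for q
    using that t_closed b_closed by (auto simp: arc_def index_def)
qed (use h_surj all_arrows_full cocycles_free in auto)

end

theorem (in tower) free_by_Z: "free_by_Z G"
proof -
  obtain n h where nh: "heights n" "h \<in> hom G integer_group" "\<forall>j\<le>N. h (t j) = n j \<and> h (b j) = 0"
    "\<exists>z\<in>carrier G. h z = 1"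
    using surjective_heights by blast
  interpret tower_heights G N t b u x y k n h
    by unfold_locales (use nh in auto)
  obtain z where "z \<in> carrier G" "h z = 1" using nh(4) by blast
  with free_action_groupoid.kernel_free[OF free_action_groupoid] show ?thesis
    using free_kernel_imp_free_by_Z[OF is_group nh(2)] by blast
qed


section \<open>Trees as rooted towers of vertices\<close>

lemma connected_closed_eq_verts:
  assumes con: "connected H" and S: "S \<subseteq> verts H" "S \<noteq> {}"
    and closed: "\<And>e. e \<in> arcs H \<Longrightarrow> tail H e \<in> S \<longleftrightarrow> head H e \<in> S"
  shows "S = verts H"
proof
  obtain r where r: "r \<in> S" using S by blast
  show "verts H \<subseteq> S"
  proof
    fix w assume w: "w \<in> verts H"
    have "(r, w) \<in> rtrancl_on (verts H) (parcs (mk_symmetric H))"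
      using con r S w unfolding connected_def strongly_connected_def reachable_def by auto
    then have "(r, w) \<in> (parcs (mk_symmetric H))\<^sup>*" by (rule rtrancl_on_rtranclI)
    then show "w \<in> S"
    proof induction
      case (step v w)
      then show ?case using closed by (auto simp: parcs_mk_symmetric)
    qed (rule r)
  qed
qed (rule S)

context bidirected_digraph
begin

text \<open>\<open>arev e'\<close> ends at the tail of \<open>e'\<close>, a vertex to which a simple
  path starting with \<open>e'\<close> does not return.\<close>

lemma apath_arev:
  "apath v p w \<Longrightarrow> e \<in> set p \<Longrightarrow> arev e \<notin> set p"
proof (induction p arbitrary: v)
  case (Cons e' p)
  have e': "e' \<in> arcs G" "apath (head G e') p w" "tail G e' \<notin> set (awalk_verts (head G e') p)"
    using Cons.prems by (auto simp: apath_Cons_iff)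
  have p: "awalk (head G e') p w" using e'(2) by (simp add: apath_def)
  have "arev e' \<notin> set p"
    using awalk_verts_arc2[OF p, of "arev e'"] e' by auto
  then show ?case
    using Cons.IH[OF e'(2)] Cons.prems(2) arev_neq[OF e'(1)] arev_arev by (metis set_ConsD)
qed simp

text \<open>An arc outside \<open>D\<close> would close a simple \<open>D\<close>-path from its head
  to its tail to a circuit; closure under \<open>arev\<close> keeps the reverse of the arc out of
  that path. The last hypothesis expresses that \<open>D\<close> connects all vertices.\<close>

lemma arcs_subset_if_no_circuit:
  assumes circ: "\<nexists>p. circuit G arev p"
    and D: "D \<subseteq> arcs G" "\<And>e. e \<in> D \<Longrightarrow> arev e \<in> D"
    and con: "\<And>S. S \<subseteq> verts G \<Longrightarrow> S \<noteq> {} \<Longrightarrow> (\<And>e. e \<in> D \<Longrightarrow> tail G e \<in> S \<Longrightarrow> head G e \<in> S) \<Longrightarrow>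
      S = verts G"
  shows "arcs G \<subseteq> D"
proof (rule ccontr)
  assume "\<not> arcs G \<subseteq> D"
  then obtain a where a: "a \<in> arcs G" "a \<notin> D" by blast
  define S where "S = {w. \<exists>p. awalk (head G a) p w \<and> set p \<subseteq> D}"
  have "S = verts G"
  proof (rule con)
    show "S \<subseteq> verts G" by (auto simp: S_def)
    have "awalk (head G a) [] (head G a)" using a by (simp add: awalk_Nil_iff)
    then show "S \<noteq> {}" unfolding S_def by (metis (mono_tags) empty_iff empty_set empty_subsetI mem_Collect_eq)
    show "head G e \<in> S" if e: "e \<in> D" "tail G e \<in> S" for e
    proof -
      obtain p where p: "awalk (head G a) p (tail G e)" "set p \<subseteq> D" using e by (auto simp: S_def)
      have "awalk (head G a) (p @ [e]) (head G e)"
        using p(1) arc_implies_awalk[of e] e D(1) by (intro awalk_appendI[OF p(1)]) auto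
      then show ?thesis using p(2) e(1) unfolding S_def by (intro CollectI exI[of _ "p @ [e]"]) auto
    qed
  qed
  then have "tail G a \<in> S" using a by simp
  then obtain p where p: "awalk (head G a) p (tail G a)" "set p \<subseteq> D" by (auto simp: S_def)
  define q where "q = awalk_to_apath p"
  have q: "apath (head G a) q (tail G a)" "set q \<subseteq> D"
    using apath_awalk_to_apath[OF p(1)] awalk_to_apath_subset[OF p(1)] p(2) by (auto simp: q_def)
  have "cycle (a # q)"
    unfolding cycle_def using q(1) a(1)
    by (intro exI[of _ "tail G a"]) (auto simp: apath_def awalk_Cons_iff)
  moreover have "arev e \<notin> set (a # q)" if "e \<in> set (a # q)" for e
    using that apath_arev[OF q(1)] q(2) a arev_neq[OF a(1)] D(2) arev_arev
    by (metis set_ConsD subsetD)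
  ultimately have "circuit G arev (a # q)" by (simp add: circuit_def)
  then show False using circ by blast
qed

text \<open>A spanning tree grown vertex by vertex, with \<open>u j\<close> the parent of
  \<open>j\<close>. Connectedness supplies an arc across the boundary of the vertices listed so
  far.\<close>

lemma connected_vertex_enumeration:
  assumes con: "connected G" and fin: "finite (verts G)"
  obtains v :: "nat \<Rightarrow> 'a" and N u a where "bij_betw v {..N} (verts G)"
    "\<And>j. 0 < j \<Longrightarrow> j \<le> N \<Longrightarrow>
      u j < j \<and> a j \<in> arcs G \<and> tail G (a j) = v (u j) \<and> head G (a j) = v j"
proof -
  define N where "N = card (verts G) - 1"
  have ne: "verts G \<noteq> {}"
    using con by (simp add: connected_def strongly_connected_def)
  then have card: "card (verts G) = Suc N" using fin by (simp add: N_def card_gt_0_iff)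
  have "\<exists>(v :: nat \<Rightarrow> 'a) u a. inj_on v {..M} \<and> v ` {..M} \<subseteq> verts G \<and>
    (\<forall>j. 0 < j \<and> j \<le> M \<longrightarrow> u j < j \<and> a j \<in> arcs G \<and> tail G (a j) = v (u j) \<and> head G (a j) = v j)"
    if "M \<le> N" for M
    using that
  proof (induction M)
    case 0
    obtain r where "r \<in> verts G" using ne by blast
    then show ?case by (intro exI[of _ "\<lambda>_. r"]) auto
  next
    case (Suc M)
    from Suc.IH[OF Suc_leD[OF Suc.prems]]
    obtain v :: "nat \<Rightarrow> 'a" and u a where v: "inj_on v {..M}" "v ` {..M} \<subseteq> verts G"
      and a: "\<forall>j. 0 < j \<and> j \<le> M \<longrightarrow>
        u j < j \<and> a j \<in> arcs G \<and> tail G (a j) = v (u j) \<and> head G (a j) = v j"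
      by blast
    have "card (v ` {..M}) \<noteq> card (verts G)"
      using v(1) Suc.prems card by (simp add: card_image)
    then have "v ` {..M} \<noteq> verts G" by auto
    then have "\<exists>e\<in>arcs G. \<not> (tail G e \<in> v ` {..M} \<longleftrightarrow> head G e \<in> v ` {..M})"
      using connected_closed_eq_verts[OF con v(2)] by blast
    then obtain e0 where e0: "e0 \<in> arcs G" "\<not> (tail G e0 \<in> v ` {..M} \<longleftrightarrow> head G e0 \<in> v ` {..M})"
      by blast
    \<comment> \<open>Reversal, if necessary, makes the crossing arc point out of the listed
      set.\<close>
    define e where "e = (if tail G e0 \<in> v ` {..M} then e0 else arev e0)"
    have e: "e \<in> arcs G" "tail G e \<in> v ` {..M}" "head G e \<notin> v ` {..M}"
      using e0 by (auto simp: e_def)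
    then obtain i where i: "i \<le> M" "tail G e = v i" by auto
    have "inj_on (v(Suc M := head G e)) {..Suc M}"
      using v(1) e(3) by (auto simp: inj_on_def le_Suc_eq image_iff eq_commute)
    moreover have "(v(Suc M := head G e)) ` {..Suc M} \<subseteq> verts G"
      using v(2) e(1) by (auto simp: le_Suc_eq)
    moreover have "(u(Suc M := i)) j < j \<and> (a(Suc M := e)) j \<in> arcs G \<and>
        tail G ((a(Suc M := e)) j) = (v(Suc M := head G e)) ((u(Suc M := i)) j) \<and>
        head G ((a(Suc M := e)) j) = (v(Suc M := head G e)) j" if "0 < j \<and> j \<le> Suc M" for j
      using that a[rule_format, of j] i e(1) by (auto simp: le_Suc_eq)
    ultimately show ?case by blast
  qed
  from this[of N] obtain v :: "nat \<Rightarrow> 'a" and u a where v: "inj_on v {..N}" "v ` {..N} \<subseteq> verts G"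
      and a: "\<forall>j. 0 < j \<and> j \<le> N \<longrightarrow>
        u j < j \<and> a j \<in> arcs G \<and> tail G (a j) = v (u j) \<and> head G (a j) = v j"
    by blast
  have "v ` {..N} = verts G"
    using v card fin by (intro card_subset_eq) (auto simp: card_image)
  then show thesis using that[of v N u a] v(1) a by (auto simp: bij_betw_def)
qed

end


section \<open>Coordinates on the vertex groups\<close>

abbreviation Z2 :: "(int \<times> int) monoid" where
  "Z2 \<equiv> integer_group \<times>\<times> integer_group"

lemma Z2_mult: "p \<otimes>\<^bsub>Z2\<^esub> q = (fst p + fst q, snd p + snd q)"
  by (simp add: mult_DirProd')

lemma group_Z2: "group Z2"
  by (simp add: DirProd_group)

lemma Z2_int_pow: "p [^]\<^bsub>Z2\<^esub> (k::int) = (k * fst p, k * snd p)"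
proof -
  have "fst \<in> hom Z2 integer_group" "snd \<in> hom Z2 integer_group"
    by (auto simp: hom_def Z2_mult)
  then show ?thesis
    using hom_int_pow[of fst Z2 integer_group p k] hom_int_pow[of snd Z2 integer_group p k] group_Z2
    by (intro prod_eqI) simp_all
qed

text \<open>
  Take the primitive vector on the ray of \<open>d\<close> as the first basis vector; adding a multiple \<open>N\<close> of it
  to the second basis vector moves all of the finitely many vectors of \<open>E\<close> off the second axis.
\<close>

lemma Z2_basis_adapted:
  assumes d: "d \<noteq> (0, 0)" and E: "finite E" "(0, 0) \<notin> E"
  shows "\<exists>f\<in>iso Z2 Z2. snd (f d) = 0 \<and> fst (f d) \<noteq> 0 \<and> (\<forall>e\<in>E. fst (f e) \<noteq> 0)"
proof -
  obtain p q where pq: "d = (p, q)" by fastforce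
  define g where "g = gcd p q"
  have g: "g \<noteq> 0" using d by (simp add: g_def pq)
  obtain p' q' where p': "p = g * p'" "q = g * q'"
    unfolding g_def by (meson dvdE gcd_dvd1 gcd_dvd2)
  obtain r s where "r * p + s * q = g" using bezout_int[of p q] by (auto simp: g_def)
  then have "g * (r * p' + s * q') = g * 1" by (simp add: p' algebra_simps)
  then have det: "r * p' + s * q' = 1" using g by simp
  \<comment> \<open>\<open>X\<close> and \<open>Y\<close> are the coordinates in the basis
    \<open>(p', q')\<close>, \<open>(- s, r)\<close>, which has determinant one by Bezout's
    identity; \<open>d\<close> lies on its first axis.\<close>
  define X where "X e = r * fst e + s * snd e" for e :: "int \<times> int"
  define Y where "Y e = p' * snd e - q' * fst e" for e :: "int \<times> int"
  \<comment> \<open>\<open>N\<close> avoids the quotients of \<open>X e\<close> by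
    \<open>Y e\<close>, so \<open>X e - N * Y e\<close> is nonzero on \<open>E\<close> when
    \<open>Y e \<noteq> 0\<close>; when \<open>Y e = 0\<close>, already
    \<open>X e \<noteq> 0\<close>.\<close>
  obtain N where N: "N \<notin> (\<lambda>e. X e div Y e) ` E"
    using ex_new_if_finite[of "(\<lambda>e. X e div Y e) ` E"] E(1) infinite_UNIV_int by blast
  define f where "f e = (X e - N * Y e, Y e)" for e
  define f' where "f' = (\<lambda>(a, c). (p' * (a + N * c) - s * c, q' * (a + N * c) + r * c))"
  have inv1: "p' * X e - s * Y e = fst e" "q' * X e + r * Y e = snd e" for e
  proof -
    have "p' * X e - s * Y e = (r * p' + s * q') * fst e"
      "q' * X e + r * Y e = (r * p' + s * q') * snd e"
      by (simp_all add: X_def Y_def algebra_simps)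
    then show "p' * X e - s * Y e = fst e" "q' * X e + r * Y e = snd e" by (simp_all add: det)
  qed
  have inv2: "X (p' * a - s * c, q' * a + r * c) = a" "Y (p' * a - s * c, q' * a + r * c) = c" for a c
  proof -
    have "X (p' * a - s * c, q' * a + r * c) = (r * p' + s * q') * a"
      "Y (p' * a - s * c, q' * a + r * c) = (r * p' + s * q') * c"
      by (simp_all add: X_def Y_def algebra_simps)
    then show "X (p' * a - s * c, q' * a + r * c) = a" "Y (p' * a - s * c, q' * a + r * c) = c"
      by (simp_all add: det)
  qed
  have "f \<in> hom Z2 Z2"
    by (auto simp: hom_def f_def X_def Y_def algebra_simps)
  moreover have "bij_betw f (carrier Z2) (carrier Z2)"
    by (rule bij_betw_byWitness[where f' = f'])
      (auto simp: f_def f'_def inv1 inv2)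
  ultimately have "f \<in> iso Z2 Z2" by (simp add: iso_def)
  moreover have "snd (f d) = 0" "fst (f d) \<noteq> 0"
  proof -
    have "X d = g * (r * p' + s * q')" "Y d = 0"
      by (simp_all add: X_def Y_def pq p' algebra_simps)
    then show "snd (f d) = 0" "fst (f d) \<noteq> 0" using g by (simp_all add: f_def det)
  qed
  moreover have "fst (f e) \<noteq> 0" if e: "e \<in> E" for e
  proof
    assume "fst (f e) = 0"
    then have X: "X e = N * Y e" by (simp add: f_def)
    show False
    proof (cases "Y e = 0")
      case True
      then have "e = (0, 0)" using inv1[of e] X by (intro prod_eqI) auto
      then show False using e E(2) by simp
    next
      case False
      then have "X e div Y e = N" using X by simp
      then show False using N e by blast
    qed
  qed
  ultimately show ?thesis by blast
qed

lemma adapted_coordinates: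
  assumes A: "group A" "A \<cong> Z2" and d: "d \<in> carrier A" "d \<noteq> \<one>\<^bsub>A\<^esub>"
    and E: "finite E" "E \<subseteq> carrier A" "\<one>\<^bsub>A\<^esub> \<notin> E"
  shows "\<exists>f\<in>iso A Z2. snd (f d) = 0 \<and> fst (f d) \<noteq> 0 \<and> (\<forall>e\<in>E. fst (f e) \<noteq> 0)"
proof -
  obtain \<psi> where \<psi>: "\<psi> \<in> iso A Z2" using A(2) by (auto simp: is_iso_def)
  interpret \<psi>: group_hom A Z2 \<psi>
    using \<psi> A(1) group_Z2 by (simp add: group_hom_def group_hom_axioms_def iso_def)
  have inj: "inj_on \<psi> (carrier A)" using \<psi> by (simp add: iso_def bij_betw_def)
  have ne: "\<psi> e \<noteq> (0, 0)" if "e \<in> carrier A" "e \<noteq> \<one>\<^bsub>A\<^esub>" for e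
    using inj_onD[OF inj, of e "\<one>\<^bsub>A\<^esub>"] that \<psi>.hom_one by auto
  have "(0, 0) \<notin> \<psi> ` E" using ne E by force
  then obtain f where f: "f \<in> iso Z2 Z2" "snd (f (\<psi> d)) = 0" "fst (f (\<psi> d)) \<noteq> 0"
    "\<forall>e\<in>\<psi> ` E. fst (f e) \<noteq> 0"
    using Z2_basis_adapted[OF ne[OF d] finite_imageI[OF E(1)]] by blast
  then show ?thesis using iso_set_trans[OF \<psi> f(1)] by (intro bexI[of _ "f \<circ> \<psi>"]) auto
qed

lemma (in group) pow_mult_pow:
  assumes "t \<in> carrier G" "b \<in> carrier G" "t \<otimes> b = b \<otimes> t"
  shows "t [^] (p + p' :: int) \<otimes> b [^] (q + q' :: int) = (t [^] p \<otimes> b [^] q) \<otimes> (t [^] p' \<otimes> b [^] q')"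
proof -
  have "b [^] q \<otimes> t = t \<otimes> b [^] q"
    using commute_int_pow[OF assms(2,1)] assms(3) by simp
  then have c: "t [^] p' \<otimes> b [^] q = b [^] q \<otimes> t [^] p'"
    using assms by (intro commute_int_pow) auto
  have "t [^] (p + p') \<otimes> b [^] (q + q') = t [^] p \<otimes> (t [^] p' \<otimes> b [^] q) \<otimes> b [^] q'"
    using assms by (simp add: int_pow_mult m_assoc)
  also have "\<dots> = (t [^] p \<otimes> b [^] q) \<otimes> (t [^] p' \<otimes> b [^] q')"
    unfolding c using assms by (simp add: m_assoc)
  finally show ?thesis .
qed

text \<open>\<int>^2 is free abelian on its unit vectors, so a commuting pair determines a
  homomorphism.\<close>

lemma (in group) pow_pair_hom:
  assumes f: "f \<in> hom A Z2" and tb: "t \<in> carrier G" "b \<in> carrier G" "t \<otimes> b = b \<otimes> t"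
  shows "(\<lambda>g. t [^] fst (f g) \<otimes> b [^] snd (f g)) \<in> hom A G"
  using f tb pow_mult_pow[OF tb]
  by (intro homI) (auto simp: hom_def Z2_mult)

lemma iso_Z2_decompose:
  assumes A: "group A" and f: "f \<in> iso A Z2" and e: "e1 \<in> carrier A" "f e1 = (1, 0)" "e2 \<in> carrier A" "f e2 = (0, 1)"
    and g: "g \<in> carrier A"
  shows "g = e1 [^]\<^bsub>A\<^esub> fst (f g) \<otimes>\<^bsub>A\<^esub> e2 [^]\<^bsub>A\<^esub> snd (f g)"
proof -
  interpret A: group A by fact
  interpret f: group_hom A Z2 f
    using f A group_Z2 by (simp add: group_hom_def group_hom_axioms_def iso_def)
  have "f (e1 [^]\<^bsub>A\<^esub> fst (f g) \<otimes>\<^bsub>A\<^esub> e2 [^]\<^bsub>A\<^esub> snd (f g)) = f g"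
    using e f.hom_int_pow by (simp add: Z2_int_pow Z2_mult)
  then show ?thesis
    using f e g by (auto simp: iso_def bij_betw_def inj_on_def)
qed

lemma iso_integer_group_generator:
  assumes A: "group A" "A \<cong> integer_group"
  obtains \<epsilon> where "\<epsilon> \<in> carrier A" "\<epsilon> \<noteq> \<one>\<^bsub>A\<^esub>" "\<And>g. g \<in> carrier A \<Longrightarrow> \<exists>z::int. g = \<epsilon> [^]\<^bsub>A\<^esub> z"
proof -
  interpret A: group A by fact
  obtain \<psi> where \<psi>: "\<psi> \<in> iso A integer_group" using A(2) by (auto simp: is_iso_def)
  interpret \<psi>: group_hom A integer_group \<psi>
    using \<psi> A(1) by (simp add: group_hom_def group_hom_axioms_def iso_def)
  have bij: "bij_betw \<psi> (carrier A) UNIV" using \<psi> by (simp add: iso_def)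
  then obtain \<epsilon> where \<epsilon>: "\<epsilon> \<in> carrier A" "\<psi> \<epsilon> = 1" unfolding bij_betw_def by (metis UNIV_I imageE)
  have "\<exists>z::int. g = \<epsilon> [^]\<^bsub>A\<^esub> z" if g: "g \<in> carrier A" for g
  proof -
    have "\<psi> (\<epsilon> [^]\<^bsub>A\<^esub> \<psi> g) = \<psi> g" using \<psi>.hom_int_pow[OF \<epsilon>(1), of "\<psi> g"] \<epsilon>(2) by simp
    then have "\<epsilon> [^]\<^bsub>A\<^esub> \<psi> g = g" using bij g \<epsilon>(1) by (auto simp: bij_betw_def inj_on_def)
    then show ?thesis by metis
  qed
  moreover have "\<epsilon> \<noteq> \<one>\<^bsub>A\<^esub>" using \<epsilon>(2) \<psi>.hom_one by auto
  ultimately show thesis using that \<epsilon>(1) by blast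
qed


section \<open>Tubular groups over trees\<close>

locale tubular_tree = tubular \<Gamma> arev VG EG \<phi>
  for \<Gamma> :: "('v, 'e) pre_digraph" and arev :: "'e \<Rightarrow> 'e"
    and VG :: "'v \<Rightarrow> ('g, 'm) monoid_scheme"
    and EG :: "'e \<Rightarrow> ('h, 'n) monoid_scheme"
    and \<phi> :: "'e \<Rightarrow> 'h \<Rightarrow> 'g" +
  fixes T :: "('v, 'e) pre_digraph"
  assumes T: "maximal_tree \<Gamma> arev T"
    and \<Gamma>_tree: "serre_tree \<Gamma> arev"
begin

abbreviation gens :: "('v, 'g, 'e) generator set" where
  "gens \<equiv> pi1_generators \<Gamma> VG"

abbreviation rels :: "(('v, 'g, 'e) generator word \<times> ('v, 'g, 'e) generator word) set" where
  "rels \<equiv> pi1_relations \<Gamma> arev VG EG \<phi> T"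

abbreviation \<pi>1 :: "('v, 'g, 'e) generator word set monoid" where
  "\<pi>1 \<equiv> presented_group gens rels"

definition \<iota> :: "'v \<Rightarrow> 'g \<Rightarrow> ('v, 'g, 'e) generator word set" where
  "\<iota> w g = word_class gens rels [(Vert w g, True)]"

lemma in_gens [simp]:
  "Vert w g \<in> gens \<longleftrightarrow> w \<in> verts \<Gamma> \<and> g \<in> carrier (VG w)"
  "Stable e \<in> gens \<longleftrightarrow> e \<in> arcs \<Gamma>"
  by (auto simp: pi1_generators_def)

section \<open>The fundamental group over a tree as an iterated amalgam\<close>

lemma no_circuit: "\<nexists>p. circuit \<Gamma> arev p"
  using \<Gamma>_tree by (simp add: serre_tree_def)

text \<open>\<open>T\<close> connects all vertices and is closed under \<open>arev\<close>, so an
  arc outside it would create a circuit. Hence every stable letter becomes trivial.\<close>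

lemma arcs_T: "arcs T = arcs \<Gamma>"
proof
  have T': "arcs T \<subseteq> arcs \<Gamma>" "verts T = verts \<Gamma>" "tail T = tail \<Gamma>" "head T = head \<Gamma>"
    "\<And>e. e \<in> arcs T \<Longrightarrow> arev e \<in> arcs T" "connected T"
    using T by (auto simp: maximal_tree_def spanning_def subgraph_def compatible_def serre_tree_def)
  show "arcs T \<subseteq> arcs \<Gamma>" by (rule T')
  show "arcs \<Gamma> \<subseteq> arcs T"
  proof (rule arcs_subset_if_no_circuit[OF no_circuit T'(1,5)])
    fix S assume S: "S \<subseteq> verts \<Gamma>" "S \<noteq> {}"
      and closed: "\<And>e. e \<in> arcs T \<Longrightarrow> tail \<Gamma> e \<in> S \<Longrightarrow> head \<Gamma> e \<in> S"
    have "tail \<Gamma> e \<in> S \<longleftrightarrow> head \<Gamma> e \<in> S" if "e \<in> arcs T" for e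
      using closed[OF that] closed[OF T'(5)[OF that]] that T'(1) by auto
    then show "S = verts \<Gamma>"
      using connected_closed_eq_verts[OF T'(6), of S] S T' by simp
  qed
qed

lemma stable_trivial:
  assumes "e \<in> arcs \<Gamma>"
  shows "word_class gens rels [(Stable e, True)] = \<one>\<^bsub>\<pi>1\<^esub>"
  unfolding presented_group_one
  by (rule word_class_relation) (use assms arcs_T in \<open>auto simp: pi1_relations_def\<close>)

lemma \<iota>_hom:
  assumes w: "w \<in> verts \<Gamma>"
  shows "\<iota> w \<in> hom (VG w) \<pi>1"
proof (rule homI)
  show "\<iota> w g \<in> carrier \<pi>1" if "g \<in> carrier (VG w)" for g
    unfolding \<iota>_def using that w by (intro word_class_closed) simp
  show "\<iota> w (g \<otimes>\<^bsub>VG w\<^esub> g') = \<iota> w g \<otimes>\<^bsub>\<pi>1\<^esub> \<iota> w g'"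
    if g: "g \<in> carrier (VG w)" "g' \<in> carrier (VG w)" for g g'
  proof -
    interpret group "VG w" by (rule vertex_group[OF w])
    have "word_class gens rels [(Vert w g, True), (Vert w g', True)]
        = word_class gens rels [(Vert w (g \<otimes>\<^bsub>VG w\<^esub> g'), True)]"
      by (rule word_class_relation) (use g w in \<open>auto simp: pi1_relations_def\<close>)
    moreover have "\<iota> w g \<otimes>\<^bsub>\<pi>1\<^esub> \<iota> w g' = word_class gens rels ([(Vert w g, True)] @ [(Vert w g', True)])"
      unfolding \<iota>_def using g w by (intro presented_group_mult) auto
    ultimately show ?thesis by (simp add: \<iota>_def)
  qed
qed

lemma \<phi>_mon:
  assumes "e \<in> arcs \<Gamma>"
  shows "\<phi> e \<in> mon (EG e) (VG (head \<Gamma> e))" "\<phi> (arev e) \<in> mon (EG e) (VG (tail \<Gamma> e))"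
  using edge_mono[OF assms] edge_mono[OF arev_in_arcs[OF assms]] edge_group_arev[OF assms]
    head_arev[OF assms] by simp_all

lemma \<phi>_closed:
  assumes "e \<in> arcs \<Gamma>" "x \<in> carrier (EG e)"
  shows "\<phi> e x \<in> carrier (VG (head \<Gamma> e))" "\<phi> (arev e) x \<in> carrier (VG (tail \<Gamma> e))"
  using \<phi>_mon[OF assms(1)] assms(2) by (auto simp: mon_def hom_def)

lemma \<iota>_edge:
  assumes e: "e \<in> arcs \<Gamma>" and x: "x \<in> carrier (EG e)"
  shows "\<iota> (head \<Gamma> e) (\<phi> e x) = \<iota> (tail \<Gamma> e) (\<phi> (arev e) x)"
proof -
  interpret P: group \<pi>1 by (rule group_presented_group)
  let ?c = "word_class gens rels" and ?g = "(Vert (head \<Gamma> e) (\<phi> e x), True)"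
  have c: "?c [?g] \<in> carrier \<pi>1" using \<phi>_closed[OF e x] e by (intro word_class_closed) simp
  have "?c ([(Stable e, True)] @ [?g] @ [(Stable e, False)])
      = ?c [(Stable e, True)] \<otimes>\<^bsub>\<pi>1\<^esub> (?c [?g] \<otimes>\<^bsub>\<pi>1\<^esub> ?c [(Stable e, False)])"
    using \<phi>_closed[OF e x] e by (subst presented_group_mult | simp)+
  also have "\<dots> = ?c [?g]"
    using word_class_inverse_letter[of "Stable e" gens rels] e c by (simp add: stable_trivial)
  finally have "?c [(Stable e, True), ?g, (Stable e, False)] = ?c [?g]" by simp
  moreover have "?c [(Stable e, True), ?g, (Stable e, False)]
      = ?c [(Vert (tail \<Gamma> e) (\<phi> (arev e) x), True)]"
    by (rule word_class_relation) (use \<phi>_closed[OF e x] e x in \<open>auto simp: pi1_relations_def\<close>)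
  ultimately show ?thesis by (simp add: \<iota>_def)
qed

lemma \<pi>1_generated:
  assumes H: "subgroup H \<pi>1" and \<iota>: "\<And>w g. w \<in> verts \<Gamma> \<Longrightarrow> g \<in> carrier (VG w) \<Longrightarrow> \<iota> w g \<in> H"
  shows "H = carrier \<pi>1"
proof (rule presented_group_generated[OF H])
  show "word_class gens rels [(z, True)] \<in> H" if "z \<in> gens" for z
    using that \<iota> stable_trivial subgroup.one_closed[OF H] by (cases z) (auto simp: \<iota>_def)
qed

text \<open>Stable letters are sent to one, which turns the conjugation relations into the agreement
  of the two maps on each edge group.\<close>

lemma \<pi>1_universal:
  assumes L: "group L" and \<theta>: "\<And>w. w \<in> verts \<Gamma> \<Longrightarrow> \<theta> w \<in> hom (VG w) L"
    and edge: "\<And>e x. e \<in> arcs \<Gamma> \<Longrightarrow> x \<in> carrier (EG e) \<Longrightarrow>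
      \<theta> (head \<Gamma> e) (\<phi> e x) = \<theta> (tail \<Gamma> e) (\<phi> (arev e) x)"
  shows "\<exists>\<sigma>\<in>hom \<pi>1 L. \<forall>w\<in>verts \<Gamma>. \<forall>g\<in>carrier (VG w). \<sigma> (\<iota> w g) = \<theta> w g"
proof -
  interpret L: group L by fact
  define val where "val z = (case z of Vert w g \<Rightarrow> \<theta> w g | Stable e \<Rightarrow> \<one>\<^bsub>L\<^esub>)" for z :: "('v, 'g, 'e) generator"
  have [simp]: "val (Vert w g) = \<theta> w g" "val (Stable e) = \<one>\<^bsub>L\<^esub>" for w g e
    by (simp_all add: val_def)
  have \<theta>_closed [simp]: "\<theta> w g \<in> carrier L" if "w \<in> verts \<Gamma>" "g \<in> carrier (VG w)" for w g
    using \<theta>[OF that(1)] that(2) by (auto simp: hom_def)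
  have \<theta>_mult: "\<theta> w (g \<otimes>\<^bsub>VG w\<^esub> g') = \<theta> w g \<otimes>\<^bsub>L\<^esub> \<theta> w g'"
    if "w \<in> verts \<Gamma>" "g \<in> carrier (VG w)" "g' \<in> carrier (VG w)" for w g g'
    using \<theta>[OF that(1)] that(2,3) by (auto simp: hom_def)
  have val: "val \<in> gens \<rightarrow> carrier L"
    by (auto simp: pi1_generators_def)
  have "word_value L val l = word_value L val r"
    if lr: "(l, r) \<in> rels" "l \<in> words gens" "r \<in> words gens" for l r
    using lr(1) unfolding pi1_relations_def
  proof (elim UnE CollectE exE conjE)
    fix w g g' assume "(l, r) = ([(Vert w g, True), (Vert w g', True)], [(Vert w (g \<otimes>\<^bsub>VG w\<^esub> g'), True)])"
      and w: "w \<in> verts \<Gamma>" "g \<in> carrier (VG w)" "g' \<in> carrier (VG w)"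
    moreover have "g \<otimes>\<^bsub>VG w\<^esub> g' \<in> carrier (VG w)"
      using w vertex_group[OF w(1)] by (simp add: group.is_monoid monoid.m_closed)
    ultimately show ?thesis by (simp add: letter_value_def \<theta>_mult)
  next
    fix e x assume "(l, r) = ([(Stable e, True), (Vert (head \<Gamma> e) (\<phi> e x), True), (Stable e, False)],
      [(Vert (tail \<Gamma> e) (\<phi> (arev e) x), True)])" and e: "e \<in> arcs \<Gamma>" "x \<in> carrier (EG e)"
    then show ?thesis using \<phi>_closed[OF e] edge[OF e] by (simp add: letter_value_def)
  qed (simp_all add: letter_value_def)
  from L.presented_group_hom[OF val this] obtain \<sigma>
    where \<sigma>: "\<sigma> \<in> hom \<pi>1 L" "\<And>z. z \<in> gens \<Longrightarrow> \<sigma> (word_class gens rels [(z, True)]) = val z"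
    by blast
  then show ?thesis by (intro bexI[of _ \<sigma>]) (simp_all add: \<iota>_def)
qed

lemma edge_relation_from_generator:
  assumes e: "e \<in> arcs \<Gamma>" and \<epsilon>: "\<epsilon> \<in> carrier (EG e)" "\<And>x. x \<in> carrier (EG e) \<Longrightarrow> \<exists>z::int. x = \<epsilon> [^]\<^bsub>EG e\<^esub> z"
    and L: "group L" and \<theta>: "\<And>w. w \<in> verts \<Gamma> \<Longrightarrow> \<theta> w \<in> hom (VG w) L"
    and eq: "\<theta> (head \<Gamma> e) (\<phi> e \<epsilon>) = \<theta> (tail \<Gamma> e) (\<phi> (arev e) \<epsilon>)"
    and x: "x \<in> carrier (EG e)"
  shows "\<theta> (head \<Gamma> e) (\<phi> e x) = \<theta> (tail \<Gamma> e) (\<phi> (arev e) x)"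
proof -
  obtain z :: int where z: "x = \<epsilon> [^]\<^bsub>EG e\<^esub> z" using \<epsilon>(2)[OF x] by blast
  have "\<theta> (head \<Gamma> e) \<circ> \<phi> e \<in> hom (EG e) L" "\<theta> (tail \<Gamma> e) \<circ> \<phi> (arev e) \<in> hom (EG e) L"
    using \<phi>_mon[OF e] \<theta>[of "head \<Gamma> e"] \<theta>[of "tail \<Gamma> e"] e by (auto simp: mon_def intro: Group.hom_compose)
  from hom_int_pow[OF this(1) \<epsilon>(1), of z] hom_int_pow[OF this(2) \<epsilon>(1), of z] show ?thesis
    using eq edge_group[OF e] L by (simp add: z)
qed

text \<open>The vertices are enumerated from a root and each vertex group gets adapted coordinates;
  the elements with coordinates the unit vectors become the pairs \<open>t j\<close>,
  \<open>b j\<close> of a tower.\<close>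

theorem free_by_Z_\<pi>1: "free_by_Z \<pi>1"
proof -
  obtain v :: "nat \<Rightarrow> 'v" and N u a where v: "bij_betw v {..N} (verts \<Gamma>)"
    and tree: "\<And>j. 0 < j \<Longrightarrow> j \<le> N \<Longrightarrow>
      u j < j \<and> a j \<in> arcs \<Gamma> \<and> tail \<Gamma> (a j) = v (u j) \<and> head \<Gamma> (a j) = v j"
    using connected_vertex_enumeration[OF connected_graph finite_verts] by blast
  have v_verts: "v j \<in> verts \<Gamma>" if "j \<le> N" for j
    using v that by (auto simp: bij_betw_def)
  define idx where "idx = inv_into {..N} v"
  have idx_v: "idx (v j) = j" if "j \<le> N" for j
    using v that by (simp add: idx_def bij_betw_def)
  have v_idx: "idx w \<le> N" "v (idx w) = w" if "w \<in> verts \<Gamma>" for w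
  proof -
    have w: "w \<in> v ` {..N}" using v that by (simp add: bij_betw_def)
    show "idx w \<le> N" using inv_into_into[OF w] by (simp add: idx_def)
    show "v (idx w) = w" using f_inv_into_f[OF w] by (simp add: idx_def)
  qed
  \<comment> \<open>The arcs of the enumeration already connect all vertices, so in a tree there are
    no others up to reversal, and every edge relation comes from a tower relation.\<close>
  have arcs_cases: "\<exists>j. 0 < j \<and> j \<le> N \<and> (e = a j \<or> e = arev (a j))" if e: "e \<in> arcs \<Gamma>" for e
  proof -
    define D where "D = a ` {1..N} \<union> arev ` a ` {1..N}"
    have "arcs \<Gamma> \<subseteq> D"
    proof (rule arcs_subset_if_no_circuit[OF no_circuit])
      show "D \<subseteq> arcs \<Gamma>" using tree by (auto simp: D_def)
      show "arev e \<in> D" if "e \<in> D" for e using that by (auto simp: D_def)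
      fix S assume S: "S \<subseteq> verts \<Gamma>" "S \<noteq> {}"
        and closed: "\<And>e. e \<in> D \<Longrightarrow> tail \<Gamma> e \<in> S \<Longrightarrow> head \<Gamma> e \<in> S"
      have step: "v (u j) \<in> S \<longleftrightarrow> v j \<in> S" if "0 < j" "j \<le> N" for j
        using closed[of "a j"] closed[of "arev (a j)"] tree[OF that] that
        by (auto simp: D_def)
      have root: "v j \<in> S \<longleftrightarrow> v 0 \<in> S" if "j \<le> N" for j
        using that
      proof (induction j rule: less_induct)
        case (less j)
        show ?case
        proof (cases "j = 0")
          case False
          then show ?thesis using less.IH[of "u j"] tree[of j] step[of j] less.prems by simp
        qed simp
      qed
      obtain w where "w \<in> S" using S by blast
      then have "v 0 \<in> S" using root[of "idx w"] v_idx[of w] S by auto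
      then have "w \<in> S" if "w \<in> verts \<Gamma>" for w using root[of "idx w"] v_idx[OF that] by simp
      then show "S = verts \<Gamma>" using S by blast
    qed
    then have "e \<in> D" using e by blast
    then show ?thesis by (auto simp: D_def Suc_le_eq)
  qed

  have "\<exists>\<epsilon>. \<epsilon> \<in> carrier (EG e) \<and> \<epsilon> \<noteq> \<one>\<^bsub>EG e\<^esub> \<and> (\<forall>x\<in>carrier (EG e). \<exists>z::int. x = \<epsilon> [^]\<^bsub>EG e\<^esub> z)"
    if "e \<in> arcs \<Gamma>" for e
    using iso_integer_group_generator[OF edge_group[OF that] edge_group_Z[OF that]] by metis
  then obtain \<epsilon> where \<epsilon>: "\<And>e. e \<in> arcs \<Gamma> \<Longrightarrow> \<epsilon> e \<in> carrier (EG e) \<and> \<epsilon> e \<noteq> \<one>\<^bsub>EG e\<^esub> \<and>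
      (\<forall>x\<in>carrier (EG e). \<exists>z::int. x = \<epsilon> e [^]\<^bsub>EG e\<^esub> z)"
    by metis
  \<comment> \<open>The generator of the edge group of \<open>a j\<close>, seen as
    \<open>d j\<close> in the vertex group of the child and as \<open>c j\<close> in that of the
    parent.\<close>
  define d where "d j = \<phi> (a j) (\<epsilon> (a j))" for j
  define c where "c j = \<phi> (arev (a j)) (\<epsilon> (a j))" for j
  have mon_ne: "\<psi> g \<noteq> \<one>\<^bsub>B\<^esub>"
    if "\<psi> \<in> mon A B" "group A" "group B" "g \<in> carrier A" "g \<noteq> \<one>\<^bsub>A\<^esub>"
    for \<psi> g and A :: "('h, 'n) monoid_scheme" and B :: "('g, 'm) monoid_scheme"
    using that hom_one[of \<psi> A B] group.is_monoid[OF that(2)] monoid.one_closed[of A]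
    by (auto simp: mon_def inj_on_def)
  have d: "d j \<in> carrier (VG (v j))" "d j \<noteq> \<one>\<^bsub>VG (v j)\<^esub>"
    and c: "c j \<in> carrier (VG (v (u j)))" "c j \<noteq> \<one>\<^bsub>VG (v (u j))\<^esub>"
    if j: "0 < j" "j \<le> N" for j
  proof -
    have e: "a j \<in> arcs \<Gamma>" "tail \<Gamma> (a j) = v (u j)" "head \<Gamma> (a j) = v j" "u j \<le> N"
      using tree[OF j] j by auto
    show "d j \<in> carrier (VG (v j))" "c j \<in> carrier (VG (v (u j)))"
      using \<phi>_closed[OF e(1)] \<epsilon>[OF e(1)] e by (auto simp: d_def c_def)
    show "d j \<noteq> \<one>\<^bsub>VG (v j)\<^esub>" "c j \<noteq> \<one>\<^bsub>VG (v (u j))\<^esub>"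
      using mon_ne[OF \<phi>_mon(1)[OF e(1)]] mon_ne[OF \<phi>_mon(2)[OF e(1)]] edge_group[OF e(1)]
        vertex_group[OF v_verts] \<epsilon>[OF e(1)] e j by (auto simp: d_def c_def)
  qed
  \<comment> \<open>The edge to the parent is put on the first axis and the edges to the children
    are kept off the second; this yields \<open>k j \<noteq> 0\<close> and
    \<open>x l \<noteq> 0\<close>.\<close>
  have "\<exists>f\<in>iso (VG (v j)) Z2. (0 < j \<longrightarrow> snd (f (d j)) = 0 \<and> fst (f (d j)) \<noteq> 0) \<and>
      (\<forall>l. 0 < l \<and> l \<le> N \<and> u l = j \<longrightarrow> fst (f (c l)) \<noteq> 0)" if j: "j \<le> N" for j
  proof -
    have A: "group (VG (v j))" "VG (v j) \<cong> Z2"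
      using vertex_group vertex_group_Z2 v_verts[OF j] by auto
    obtain \<psi> where \<psi>: "\<psi> \<in> iso (VG (v j)) Z2" using A(2) by (auto simp: is_iso_def)
    have "\<exists>g\<in>carrier (VG (v j)). \<psi> g = (1, 0)"
      using \<psi> unfolding iso_def bij_betw_def by (simp add: image_iff) (metis UNIV_I imageE)
    moreover have "\<psi> \<one>\<^bsub>VG (v j)\<^esub> = (0, 0)"
      using hom_one[of \<psi> "VG (v j)" Z2] \<psi> A(1) group_Z2 by (simp add: iso_def)
    ultimately obtain g where g: "g \<in> carrier (VG (v j))" "g \<noteq> \<one>\<^bsub>VG (v j)\<^esub>" by force
    \<comment> \<open>The root has no parent edge; an arbitrary nontrivial element takes its
      place.\<close>
    define d' where "d' = (if j = 0 then g else d j)"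
    have d': "d' \<in> carrier (VG (v j))" "d' \<noteq> \<one>\<^bsub>VG (v j)\<^esub>"
      using g d[of j] j by (auto simp: d'_def)
    have E: "finite (c ` {l. 0 < l \<and> l \<le> N \<and> u l = j})"
      "c ` {l. 0 < l \<and> l \<le> N \<and> u l = j} \<subseteq> carrier (VG (v j))"
      "\<one>\<^bsub>VG (v j)\<^esub> \<notin> c ` {l. 0 < l \<and> l \<le> N \<and> u l = j}"
      using c by auto (metis c(2))
    from adapted_coordinates[OF A d' E] show ?thesis
      by (auto simp: d'_def)
  qed
  then obtain f where f_all: "\<forall>j\<le>N. f j \<in> iso (VG (v j)) Z2 \<and>
      (0 < j \<longrightarrow> snd (f j (d j)) = 0 \<and> fst (f j (d j)) \<noteq> 0) \<and>
      (\<forall>l. 0 < l \<and> l \<le> N \<and> u l = j \<longrightarrow> fst (f j (c l)) \<noteq> 0)"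
    by metis
  then have f: "\<And>j. j \<le> N \<Longrightarrow> f j \<in> iso (VG (v j)) Z2"
    and fd: "\<And>j. 0 < j \<Longrightarrow> j \<le> N \<Longrightarrow> snd (f j (d j)) = 0 \<and> fst (f j (d j)) \<noteq> 0"
    and fc: "\<And>l. 0 < l \<Longrightarrow> l \<le> N \<Longrightarrow> u l \<le> N \<Longrightarrow> fst (f (u l) (c l)) \<noteq> 0"
    by simp_all
  have u_le: "u j \<le> N" if "0 < j" "j \<le> N" for j using tree[OF that] that by simp
  define pre where "pre j = inv_into (carrier (VG (v j))) (f j)" for j
  have pre: "pre j p \<in> carrier (VG (v j)) \<and> f j (pre j p) = p" if "j \<le> N" for j p
  proof -
    have "p \<in> f j ` carrier (VG (v j))"
      using f[OF that] by (simp add: iso_def bij_betw_def)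
    then show ?thesis unfolding pre_def by (blast intro: inv_into_into f_inv_into_f)
  qed
  define e1 where "e1 j = pre j (1, 0)" for j
  define e2 where "e2 j = pre j (0, 1)" for j
  have e1: "e1 j \<in> carrier (VG (v j)) \<and> f j (e1 j) = (1, 0)"
    and e2: "e2 j \<in> carrier (VG (v j)) \<and> f j (e2 j) = (0, 1)" if "j \<le> N" for j
    unfolding e1_def e2_def using pre[OF that] by blast+
  define t where "t j = \<iota> (v j) (e1 j)" for j
  define b where "b j = \<iota> (v j) (e2 j)" for j
  define x where "x j = fst (f (u j) (c j))" for j
  define y where "y j = snd (f (u j) (c j))" for j
  define k where "k j = (if j = 0 then 1 else fst (f j (d j)))" for j
  interpret P: group \<pi>1 by (rule group_presented_group)
  have \<iota>_decompose: "\<iota> (v j) g = t j [^]\<^bsub>\<pi>1\<^esub> fst (f j g) \<otimes>\<^bsub>\<pi>1\<^esub> b j [^]\<^bsub>\<pi>1\<^esub> snd (f j g)"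
    if j: "j \<le> N" and g: "g \<in> carrier (VG (v j))" for j g
  proof -
    interpret V: group "VG (v j)" by (rule vertex_group[OF v_verts[OF j]])
    interpret \<iota>: group_hom "VG (v j)" \<pi>1 "\<iota> (v j)"
      using \<iota>_hom[OF v_verts[OF j]]
      by (simp add: group_hom_def group_hom_axioms_def V.is_group P.is_group)
    have "g = e1 j [^]\<^bsub>VG (v j)\<^esub> fst (f j g) \<otimes>\<^bsub>VG (v j)\<^esub> e2 j [^]\<^bsub>VG (v j)\<^esub> snd (f j g)"
      using iso_Z2_decompose[OF V.is_group f[OF j]] e1[OF j] e2[OF j] g by blast
    then have "\<iota> (v j) g
        = \<iota> (v j) (e1 j [^]\<^bsub>VG (v j)\<^esub> fst (f j g) \<otimes>\<^bsub>VG (v j)\<^esub> e2 j [^]\<^bsub>VG (v j)\<^esub> snd (f j g))"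
      by simp
    also have "\<dots> = t j [^]\<^bsub>\<pi>1\<^esub> fst (f j g) \<otimes>\<^bsub>\<pi>1\<^esub> b j [^]\<^bsub>\<pi>1\<^esub> snd (f j g)"
      using e1[OF j] e2[OF j] \<iota>.hom_int_pow by (simp add: t_def b_def)
    finally show ?thesis .
  qed
  have tb_closed: "t j \<in> carrier \<pi>1" "b j \<in> carrier \<pi>1" if "j \<le> N" for j
    using \<iota>_hom[OF v_verts[OF that]] e1[OF that] e2[OF that] by (auto simp: t_def b_def hom_def)
  have \<iota>_cd: "\<iota> (v (u j)) (c j) = \<iota> (v j) (d j)" if "0 < j" "j \<le> N" for j
    using \<iota>_edge[of "a j" "\<epsilon> (a j)"] tree[OF that] \<epsilon>[of "a j"] by (auto simp: c_def d_def)

  interpret tower \<pi>1 N t b u x y k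
  proof (intro tower.intro tower_axioms.intro P.is_group)
    fix j assume j: "j \<le> N"
    show "t j \<in> carrier \<pi>1" "b j \<in> carrier \<pi>1" by (fact tb_closed[OF j])+
    interpret V: group "VG (v j)" by (rule vertex_group[OF v_verts[OF j]])
    have "e1 j \<otimes>\<^bsub>VG (v j)\<^esub> e2 j = e2 j \<otimes>\<^bsub>VG (v j)\<^esub> e1 j"
    proof -
      have "f j (e1 j \<otimes>\<^bsub>VG (v j)\<^esub> e2 j) = f j (e2 j \<otimes>\<^bsub>VG (v j)\<^esub> e1 j)"
        using f[OF j] e1[OF j] e2[OF j] by (simp add: iso_def hom_def)
      then show ?thesis
        using f[OF j] e1[OF j] e2[OF j] by (auto simp: iso_def bij_betw_def inj_on_def)
    qed
    then show "t j \<otimes>\<^bsub>\<pi>1\<^esub> b j = b j \<otimes>\<^bsub>\<pi>1\<^esub> t j"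
      using hom_mult[OF \<iota>_hom[OF v_verts[OF j]], of "e1 j" "e2 j"]
        hom_mult[OF \<iota>_hom[OF v_verts[OF j]], of "e2 j" "e1 j"] e1[OF j] e2[OF j]
      by (simp add: t_def b_def)
    show "k j \<noteq> 0" using fd[of j] j by (auto simp: k_def)
  next
    fix j assume j: "0 < j" "j \<le> N"
    show "u j < j" using tree[OF j] by simp
    show "x j \<noteq> 0" using fc[OF j u_le[OF j]] by (simp add: x_def)
    have "t (u j) [^]\<^bsub>\<pi>1\<^esub> x j \<otimes>\<^bsub>\<pi>1\<^esub> b (u j) [^]\<^bsub>\<pi>1\<^esub> y j = \<iota> (v (u j)) (c j)"
      using \<iota>_decompose[OF u_le[OF j] c(1)[OF j]] by (simp add: x_def y_def)
    also have "\<dots> = \<iota> (v j) (d j)" by (rule \<iota>_cd[OF j])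
    also have "\<dots> = t j [^]\<^bsub>\<pi>1\<^esub> k j"
      using \<iota>_decompose[OF j(2) d(1)[OF j]] fd[OF j] tb_closed[OF j(2)] j by (simp add: k_def)
    finally show "t (u j) [^]\<^bsub>\<pi>1\<^esub> x j \<otimes>\<^bsub>\<pi>1\<^esub> b (u j) [^]\<^bsub>\<pi>1\<^esub> y j = t j [^]\<^bsub>\<pi>1\<^esub> k j" .
  next
    show "k 0 = 1" by (simp add: k_def)
  next
    fix H assume H: "subgroup H \<pi>1" and tb: "\<And>j. j \<le> N \<Longrightarrow> t j \<in> H \<and> b j \<in> H"
    show "H = carrier \<pi>1"
    proof (rule \<pi>1_generated[OF H])
      fix w g assume w: "w \<in> verts \<Gamma>" "g \<in> carrier (VG w)"
      have "t (idx w) [^]\<^bsub>\<pi>1\<^esub> fst (f (idx w) g) \<otimes>\<^bsub>\<pi>1\<^esub> b (idx w) [^]\<^bsub>\<pi>1\<^esub> snd (f (idx w) g) \<in> H"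
        using tb[OF v_idx(1)[OF w(1)]]
        by (intro subgroup.m_closed[OF H] P.subgroup_int_pow_closed[OF H]) auto
      then show "\<iota> w g \<in> H"
        using \<iota>_decompose[of "idx w" g] v_idx[OF w(1)] w(2) by simp
    qed
  next
    fix L :: "((int \<Rightarrow> nat word set) \<times> int) monoid" and t' b'
    assume L: "group L"
      and tb': "\<And>j. j \<le> N \<Longrightarrow> t' j \<in> carrier L \<and> b' j \<in> carrier L \<and> t' j \<otimes>\<^bsub>L\<^esub> b' j = b' j \<otimes>\<^bsub>L\<^esub> t' j"
      and rel: "\<And>j. 0 < j \<Longrightarrow> j \<le> N \<Longrightarrow>
        t' (u j) [^]\<^bsub>L\<^esub> x j \<otimes>\<^bsub>L\<^esub> b' (u j) [^]\<^bsub>L\<^esub> y j = t' j [^]\<^bsub>L\<^esub> k j"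
    interpret L: group L by (rule L)
    \<comment> \<open>The commuting pair given for each vertex, spread over its vertex group by the
      coordinates.\<close>
    define \<theta> where "\<theta> w g = t' (idx w) [^]\<^bsub>L\<^esub> fst (f (idx w) g) \<otimes>\<^bsub>L\<^esub> b' (idx w) [^]\<^bsub>L\<^esub> snd (f (idx w) g)"
      for w g
    have \<theta>: "\<theta> w \<in> hom (VG w) L" if w: "w \<in> verts \<Gamma>" for w
      unfolding \<theta>_def using f[OF v_idx(1)[OF w]] tb'[OF v_idx(1)[OF w]] v_idx(2)[OF w]
      by (intro L.pow_pair_hom) (auto simp: iso_def)
    have cd: "\<theta> (v (u j)) (c j) = \<theta> (v j) (d j)" if j: "0 < j" "j \<le> N" for j
      using rel[OF j] fd[OF j] j tb'[OF j(2)]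
      by (simp add: \<theta>_def idx_v[OF j(2)] idx_v[OF u_le[OF j]] x_def y_def k_def)
    have "\<theta> (head \<Gamma> e) (\<phi> e z) = \<theta> (tail \<Gamma> e) (\<phi> (arev e) z)"
      if e: "e \<in> arcs \<Gamma>" and z: "z \<in> carrier (EG e)" for e z
    proof -
      obtain j where j: "0 < j" "j \<le> N" and ej: "e = a j \<or> e = arev (a j)" using arcs_cases[OF e] by blast
      have aj: "a j \<in> arcs \<Gamma>" "tail \<Gamma> (a j) = v (u j)" "head \<Gamma> (a j) = v j" using tree[OF j] by auto
      \<comment> \<open>Both orientations of an edge give the same condition, and the edge group is
        cyclic, so comparing \<open>c j\<close> with \<open>d j\<close> is enough.\<close>
      have "\<theta> (head \<Gamma> (a j)) (\<phi> (a j) z) = \<theta> (tail \<Gamma> (a j)) (\<phi> (arev (a j)) z)"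
      proof (rule edge_relation_from_generator[OF aj(1) _ _ L \<theta>])
        show "\<epsilon> (a j) \<in> carrier (EG (a j))" using \<epsilon>[OF aj(1)] by simp
        show "\<exists>n::int. g = \<epsilon> (a j) [^]\<^bsub>EG (a j)\<^esub> n" if "g \<in> carrier (EG (a j))" for g
          using \<epsilon>[OF aj(1)] that by blast
        show "\<theta> (head \<Gamma> (a j)) (\<phi> (a j) (\<epsilon> (a j))) = \<theta> (tail \<Gamma> (a j)) (\<phi> (arev (a j)) (\<epsilon> (a j)))"
          using cd[OF j] aj by (simp add: c_def d_def)
        show "z \<in> carrier (EG (a j))" using z ej edge_group_arev[OF aj(1)] by auto
      qed
      then show ?thesis using ej aj(1) by auto
    qed
    from \<pi>1_universal[OF L \<theta> this] obtain \<sigma> where \<sigma>: "\<sigma> \<in> hom \<pi>1 L"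
      "\<And>w g. w \<in> verts \<Gamma> \<Longrightarrow> g \<in> carrier (VG w) \<Longrightarrow> \<sigma> (\<iota> w g) = \<theta> w g" by blast
    have "\<sigma> (t j) = t' j \<and> \<sigma> (b j) = b' j" if j: "j \<le> N" for j
      using \<sigma>(2)[OF v_verts[OF j]] e1[OF j] e2[OF j] tb'[OF j]
      by (simp add: t_def b_def \<theta>_def idx_v[OF j])
    then show "\<exists>\<sigma>\<in>hom \<pi>1 L. \<forall>j\<le>N. \<sigma> (t j) = t' j \<and> \<sigma> (b j) = b' j" using \<sigma>(1) by blast
  qed
  show ?thesis by (rule free_by_Z)
qed

end

theorem corollary2p3:
  fixes \<Gamma> T :: "('v, 'e) pre_digraph" and arev :: "'e \<Rightarrow> 'e"
    and VG :: "'v \<Rightarrow> ('g, 'm) monoid_scheme"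
    and EG :: "'e \<Rightarrow> ('h, 'n) monoid_scheme"
    and \<phi> :: "'e \<Rightarrow> 'h \<Rightarrow> 'g"
  assumes "tubular \<Gamma> arev VG EG \<phi>"
    and "maximal_tree \<Gamma> arev T"
    and "serre_tree \<Gamma> arev"
  shows "free_by_Z (fundamental_group \<Gamma> arev VG EG \<phi> T)"
  unfolding fundamental_group_def
  by (rule tubular_tree.free_by_Z_\<pi>1) (intro tubular_tree.intro tubular_tree_axioms.intro assms)

end
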